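(* Let $\Sigma$ be a closed surface with a cell decomposition, with set of edges $E$ and set of faces $F$, and let $D:E\to(0,\pi)$ and $\Phi:F\to(0,\infty)$ be functions. Then there exists a unique (up to similarity) Euclidean circle pattern on $\Sigma$ with intersection angle function $D$ and cone angle function $\Phi$ if and only if $$\sum_{f\in F}\tfrac12\Phi(f)=\sum_{e\in E}D(e)$$ and $$\sum_{f\in X}\tfrac12\Phi(f)<\sum_{e\in E(X)}D(e)$$ for any nonempty subset $X\subset F$, $X\neq F$.
   Context: For $e\in E$, $f\in F$, write $e<f$ if $e$ is an edge of $f$. For $X\subseteq F$, $E(X)=\{e\in E\mid e<f\in X\}$ is the set of edges contained in at least one of the faces in $X$. Circle pattern: given a radius function $r:F\to(0,\infty)$ and an intersection angle function $D:E\to(0,\pi)$, choose a point $O_f$ in the interior of each face $f$. If faces $f,f'$ share an edge $e$ with end points $P,Q$, realize the quadrilateral $O_fPO_{f'}Q$ as a Euclidean quadrilateral with $|O_fP|=|O_fQ|=r(f)$, $|O_{f'}P|=|O_{f'}Q|=r(f')$ and $\angle O_fPO_{f'}=\angle O_fQO_{f'}=\pi-D(e)$. Gluing together all these quadrilaterals gives a Euclidean structure on $\Sigma$ with cone points, in which each face $f$ has a circumcircle with center $O_f$ and radius $r(f)$, and the circumcircles of $f$ and $f'$ intersect at angle $D(e)$. This is called a Euclidean circle pattern. Let $\varphi(f,e)$ be the angle at $O_f$ in the Euclidean triangle $O_fPO_{f'}$. The cone angle at $O_f$ is $\Phi(f)=\sum_{e<f}2\varphi(f,e)$, the sum running over all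 edges of $f$; the resulting $\Phi:F\to(0,\infty)$ is the cone angle function of the circle pattern. *)

theory Defs
  imports "HOL-Analysis.Analysis"
begin

definition closed_surface :: "'a topology \<Rightarrow> bool" where
  "closed_surface S \<longleftrightarrow>
     topspace S \<noteq> {} \<and> compact_space S \<and> connected_space S \<and> Hausdorff_space S \<and>
     (\<forall>x\<in>topspace S. \<exists>U. openin S U \<and> x \<in> U \<and>
        subtopology S U homeomorphic_space (euclidean :: complex topology))"


text \<open>Cells are open cells. Each face carries a characteristic map from the closed unit disc,
  regarded as a polygon: the unit circle is subdivided by the \<open>degree C f\<close>-th roots of unity into
  sides. The degree may be 1 or 2, and it is 0 if the whole circle goes to a vertex (the sphere
  decomposed into one vertex and one face).\<close>

record 'a cell_complex =
  verts :: "'a set"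
  edges :: "'a set set"
  faces :: "'a set set"
  degree :: "'a set \<Rightarrow> nat"
  char_map :: "'a set \<Rightarrow> complex \<Rightarrow> 'a"

definition side_arc :: "nat \<Rightarrow> nat \<Rightarrow> complex set" where
  "side_arc n k = {cis t |t. 2 * pi * real k / real n < t \<and> t < 2 * pi * real (k + 1) / real n}"

definition edge_cell :: "'a topology \<Rightarrow> 'a set \<Rightarrow> 'a set \<Rightarrow> bool" where
  "edge_cell S V e \<longleftrightarrow>
     (\<exists>g. continuous_map (top_of_set {0..1::real}) S g \<and> g ` {0, 1} \<subseteq> V \<and>
          homeomorphic_map (top_of_set {0<..<1}) (subtopology S e) g)"

definition face_cell :: "'a topology \<Rightarrow> 'a set \<Rightarrow> 'a set set \<Rightarrow> nat \<Rightarrow> (complex \<Rightarrow> 'a) \<Rightarrow> 'a set \<Rightarrow> bool"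
  where
  "face_cell S V E n h f \<longleftrightarrow>
     continuous_map (top_of_set (cball 0 1)) S h \<and>
     homeomorphic_map (top_of_set (ball 0 1)) (subtopology S f) h \<and>
     (\<forall>k<n. \<exists>e\<in>E. homeomorphic_map (top_of_set (side_arc n k)) (subtopology S e) h) \<and>
     h ` (sphere 0 1 - (\<Union>k<n. side_arc n k)) \<subseteq> V"

definition cell_decomposition :: "'a topology \<Rightarrow> 'a cell_complex \<Rightarrow> bool" where
  "cell_decomposition S C \<longleftrightarrow>
     finite (verts C) \<and> finite (edges C) \<and> finite (faces C) \<and>
     verts C \<union> \<Union> (edges C) \<union> \<Union> (faces C) = topspace S \<and>
     verts C \<inter> \<Union> (edges C) = {} \<and> verts C \<inter> \<Union> (faces C) = {} \<and>
     \<Union> (edges C) \<inter> \<Union> (faces C) = {} \<and>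
     pairwise disjnt (edges C) \<and> pairwise disjnt (faces C) \<and>
     (\<forall>e\<in>edges C. edge_cell S (verts C) e) \<and>
     (\<forall>f\<in>faces C. face_cell S (verts C) (edges C) (degree C f) (char_map C f) f)"


text \<open>The pair \<open>(f, k)\<close> is the \<open>k\<close>-th side of the face \<open>f\<close>. A face may lie on both sides of an edge,
  and two faces may share several edges, so the quantities of a circle pattern are indexed by sides
  and not by pairs of a face and an edge.\<close>

definition sides :: "'a cell_complex \<Rightarrow> ('a set \<times> nat) set" where
  "sides C = {(f, k). f \<in> faces C \<and> k < degree C f}"

definition side_edge :: "'a cell_complex \<Rightarrow> 'a set \<times> nat \<Rightarrow> 'a set" where
  "side_edge C s = char_map C (fst s) ` side_arc (degree C (fst s)) (snd s)"

definition is_edge_of :: "'a cell_complex \<Rightarrow> 'a set \<Rightarrow> 'a set \<Rightarrow> bool" where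
  "is_edge_of C e f \<longleftrightarrow> e \<in> edges C \<and> (\<exists>k<degree C f. side_edge C (f, k) = e)"

definition edges_of :: "'a cell_complex \<Rightarrow> 'a set set \<Rightarrow> 'a set set" where
  "edges_of C X = {e \<in> edges C. \<exists>f\<in>X. is_edge_of C e f}"

text \<open>On a closed surface every edge is met by exactly two sides, so the following description
  is definite.\<close>

definition opposite_side :: "'a cell_complex \<Rightarrow> 'a set \<times> nat \<Rightarrow> 'a set \<times> nat" where
  "opposite_side C s = (THE s'. s' \<in> sides C \<and> s' \<noteq> s \<and> side_edge C s' = side_edge C s)"


definition angle_at :: "complex \<Rightarrow> complex \<Rightarrow> complex \<Rightarrow> real" where
  "angle_at A B C = arccos (((A - B) \<bullet> (C - B)) / (norm (A - B) * norm (C - B)))"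

text \<open>For each edge \<open>e\<close>, with sides \<open>s\<close> and \<open>s'\<close>, a circle pattern has a quadrilateral in the plane
  with the consecutive vertices \<open>centre s\<close>, \<open>corner1 e\<close>, \<open>centre s'\<close>, \<open>corner2 e\<close>; the corners
  represent the end points of \<open>e\<close>. Each quadrilateral lives in its own copy of the plane, so a face
  has one copy of its centre for each of its sides. Quadrilaterals at consecutive sides of a
  face \<open>f\<close> are glued along segments from the centre to a corner, both of length \<open>radius f\<close>.\<close>

record 'a circle_pattern =
  radius :: "'a set \<Rightarrow> real"
  centre :: "'a set \<times> nat \<Rightarrow> complex"
  corner1 :: "'a set \<Rightarrow> complex"
  corner2 :: "'a set \<Rightarrow> complex"

text \<open>The corners are required to be distinct in order to exclude quadrilaterals that are folded
  up along the line of centres; then the corners are mirror images in that line.\<close>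

definition euclidean_circle_pattern ::
    "'a cell_complex \<Rightarrow> ('a set \<Rightarrow> real) \<Rightarrow> 'a circle_pattern \<Rightarrow> bool" where
  "euclidean_circle_pattern C D p \<longleftrightarrow>
     (\<forall>f\<in>faces C. 0 < radius p f) \<and>
     (\<forall>s\<in>sides C.
        let e = side_edge C s; O1 = centre p s; O2 = centre p (opposite_side C s);
            P = corner1 p e; Q = corner2 p e
        in P \<noteq> Q \<and>
           dist O1 P = radius p (fst s) \<and> dist O1 Q = radius p (fst s) \<and>
           dist O2 P = radius p (fst (opposite_side C s)) \<and>
           dist O2 Q = radius p (fst (opposite_side C s)) \<and>
           angle_at O1 P O2 = pi - D e \<and> angle_at O1 Q O2 = pi - D e)"

definition half_angle :: "'a cell_complex \<Rightarrow> 'a circle_pattern \<Rightarrow> 'a set \<times> nat \<Rightarrow> real" where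
  "half_angle C p s =
     angle_at (corner1 p (side_edge C s)) (centre p s) (centre p (opposite_side C s))"

definition cone_angle :: "'a cell_complex \<Rightarrow> 'a circle_pattern \<Rightarrow> 'a set \<Rightarrow> real" where
  "cone_angle C p f = (\<Sum>k<degree C f. 2 * half_angle C p (f, k))"

text \<open>A similarity of circle patterns maps each quadrilateral to the corresponding one by a
  similarity of the plane; the scaling factor is the same for all quadrilaterals.\<close>

definition similar_patterns ::
    "'a cell_complex \<Rightarrow> 'a circle_pattern \<Rightarrow> 'a circle_pattern \<Rightarrow> bool" where
  "similar_patterns C p q \<longleftrightarrow>
     (\<exists>c>0. (\<forall>f\<in>faces C. radius q f = c * radius p f) \<and>
        (\<forall>e\<in>edges C. \<exists>T :: complex \<Rightarrow> complex.
           (\<forall>x y. dist (T x) (T y) = c * dist x y) \<and>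
           T (corner1 p e) = corner1 q e \<and> T (corner2 p e) = corner2 q e \<and>
           (\<forall>s\<in>sides C. side_edge C s = e \<longrightarrow> T (centre p s) = centre q s)))"

end

theory Submission
  imports Defs
begin

text \<open>For logarithmic radii \<open>\<rho>\<close> the half angle at a side \<open>s\<close> of a face is a strictly increasing function
  of \<open>\<rho> (opposite face) - \<rho> (face)\<close> with values in \<open>(0, D)\<close>, and the half angles at the two sides
  of an edge add up to \<open>D\<close>. Summing over the faces in \<open>X\<close> gives necessity, the inequality being
  strict because some edge separates \<open>X\<close> from its complement. The cone angle of a face decreases in its own
  radius and increases in the others; hence two solutions differ by a constant (maximum principle),
  and Perron's method solves the equations in a box \<open>[0, M]^F\<close> up to obstacles on the boundary. If both
  obstacles were active for large \<open>M\<close>, the values of \<open>\<rho>\<close> would have a long gap, across which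
  the angles almost vanish, contradicting the inequality for the faces below the gap.

  That every edge has exactly two sides follows from invariance of domain: an edge with fewer sides would
  have a neighbourhood homeomorphic to a non-open subset of the plane, and if there were three
  sides, the open disc formed by two of them would miss the third. An edge joins any
  set of faces to its complement because a surface minus finitely many points is connected.\<close>

section \<open>Angles of kites and the discrete cone angle map\<close>

text \<open>In the triangle with sides \<open>r1\<close>, \<open>r2\<close> and enclosed angle \<open>pi - D\<close>, the angle at the centre of the
  circle of radius \<open>r1\<close> has cotangent \<open>(r1 / r2 + cos D) / sin D\<close>; here \<open>x = ln (r2 / r1)\<close>.\<close>

definition kite_angle :: "real \<Rightarrow> real \<Rightarrow> real" where
  "kite_angle D x = pi / 2 - arctan ((exp (- x) + cos D) / sin D)"

text \<open>Expanding \<open>sin (D - t)\<close> turns the law of sines into cot t = (exp (- x) +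
  cos D) / sin D, and the cotangent is injective on (0, pi). Angles of actual triangles are
  identified through this criterion.\<close>

lemma kite_angle_unique:
  assumes D: "0 < D" "D < pi" and t: "0 < t" "t < pi" and eq: "sin (D - t) = exp (- x) * sin t"
  shows "kite_angle D x = t"
proof -
  have s: "sin D > 0" "sin t > 0" using D t sin_gt_zero by auto
  have "sin D * cos t - cos D * sin t = exp (- x) * sin t"
    using eq by (simp add: sin_diff)
  then have "sin D * cos t = (exp (- x) + cos D) * sin t" by (simp add: algebra_simps)
  then have "(exp (- x) + cos D) / sin D = cos t / sin t"
    using s by (simp add: field_simps)
  also have "\<dots> = tan (pi / 2 - t)"
    by (simp add: tan_def sin_diff cos_diff)
  finally have "arctan ((exp (- x) + cos D) / sin D) = pi / 2 - t"
    using t by (simp add: arctan_tan)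
  then show ?thesis by (simp add: kite_angle_def)
qed

text \<open>The law of sines: the third angle of the triangle is \<open>D - kite_angle D x\<close>,
  it lies opposite the side of length \<open>r1\<close>, and exp (- x) = r1 / r2.\<close>

lemma sin_kite_angle:
  assumes D: "0 < D" "D < pi"
  shows "sin (D - kite_angle D x) = exp (- x) * sin (kite_angle D x)"
proof -
  define c where "c = (exp (- x) + cos D) / sin D"
  have s: "sin D > 0" using D sin_gt_zero by auto
  have c: "c * sin D = exp (- x) + cos D" using s by (simp add: c_def)
  have "sin (kite_angle D x) = cos (arctan c)" "cos (kite_angle D x) = sin (arctan c)"
    by (simp_all add: kite_angle_def c_def[symmetric] sin_diff cos_diff)
  moreover have "sin (arctan c) = c * cos (arctan c)"
    using tan_arctan[of c] cos_arctan_not_zero[of c] by (simp add: tan_def field_simps)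
  ultimately have "sin (D - kite_angle D x) = (c * sin D - cos D) * cos (arctan c)"
    by (simp add: sin_diff algebra_simps)
  with c \<open>sin (kite_angle D x) = _\<close> show ?thesis by simp
qed

lemma kite_angle_less_pi: "kite_angle D x < pi" and kite_angle_pos: "0 < kite_angle D x"
  using arctan_bounded[of "(exp (- x) + cos D) / sin D"] by (auto simp: kite_angle_def)

text \<open>Otherwise \<open>sin (D - kite_angle D x)\<close> would be nonpositive, whereas the law
  of sines makes it positive.\<close>

lemma kite_angle_less:
  assumes D: "0 < D" "D < pi"
  shows "kite_angle D x < D"
proof (rule ccontr)
  assume "\<not> ?thesis"
  then have "0 \<le> kite_angle D x - D" "kite_angle D x - D < pi"
    using kite_angle_less_pi[of D x] D by auto
  then have "sin (kite_angle D x - D) \<ge> 0" by (intro sin_ge_zero) auto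
  moreover have "sin (D - kite_angle D x) > 0"
    unfolding sin_kite_angle[OF D]
    using kite_angle_less_pi kite_angle_pos by (intro mult_pos_pos sin_gt_zero) auto
  ultimately show False using sin_minus[of "D - kite_angle D x"] by simp
qed

text \<open>Changing the sign of \<open>x\<close> exchanges the two circles; the law of sines, read
  from the other centre, identifies the angle there as \<open>D - kite_angle D x\<close>.\<close>

lemma kite_angle_minus:
  assumes D: "0 < D" "D < pi"
  shows "kite_angle D x + kite_angle D (- x) = D"
proof -
  have "kite_angle D (- x) = D - kite_angle D x"
    using kite_angle_less[OF D, of x] kite_angle_pos[of D x] D sin_kite_angle[OF D, of x]
    by (intro kite_angle_unique) (auto simp: exp_minus field_simps)
  then show ?thesis by simp
qed

lemma kite_angle_strict_mono:
  assumes D: "0 < D" "D < pi" and "x < y"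
  shows "kite_angle D x < kite_angle D y"
proof -
  have "sin D > 0" using D sin_gt_zero by auto
  then show ?thesis using \<open>x < y\<close> unfolding kite_angle_def
    by (auto intro!: arctan_monotone divide_strict_right_mono)
qed

lemma kite_angle_mono:
  assumes "0 < D" "D < pi" and "x \<le> y"
  shows "kite_angle D x \<le> kite_angle D y"
  using kite_angle_strict_mono[of D x y] assms by (cases "x = y") auto

lemma continuous_kite_angle:
  assumes D: "0 < D" "D < pi"
  shows "isCont (kite_angle D) x"
proof -
  have "sin D \<noteq> 0" using D sin_gt_zero[of D] by auto
  then show ?thesis unfolding kite_angle_def by (intro continuous_intros) auto
qed

text \<open>At the centre of a circle that is far larger than its neighbour the angle vanishes in
  the limit: its cotangent grows like \<open>exp L\<close>.\<close>

lemma kite_angle_at_bot: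
  assumes D: "0 < D" "D < pi"
  shows "((\<lambda>L. kite_angle D (- L)) \<longlongrightarrow> 0) at_top"
proof -
  have s: "sin D > 0" using D sin_gt_zero by auto
  have "filterlim (\<lambda>L. (1 / sin D) * (cos D + exp L)) at_top at_top"
    using s by (intro filterlim_tendsto_pos_mult_at_top[OF tendsto_const]
       filterlim_tendsto_add_at_top[OF tendsto_const] exp_at_top) auto
  then have "filterlim (\<lambda>L. (exp L + cos D) / sin D) at_top at_top"
    by (simp add: add.commute)
  then have "((\<lambda>L. arctan ((exp L + cos D) / sin D)) \<longlongrightarrow> pi / 2) at_top"
    by (rule filterlim_compose[OF tendsto_arctan_at_top])
  then have "((\<lambda>L. pi / 2 - arctan ((exp L + cos D) / sin D)) \<longlongrightarrow> pi / 2 - pi / 2) at_top"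
    by (intro tendsto_intros)
  then show ?thesis by (simp add: kite_angle_def)
qed

text \<open>Pigeonhole: without a gap, each window from \<open>k * L\<close> to
  \<open>k * L + L\<close> with \<open>k < card F\<close> would contain a further value.\<close>

lemma gap_in_values:
  fixes \<sigma> :: "'f \<Rightarrow> real"
  assumes fin: "finite F" and L: "L > 0" and a: "a \<in> F" "\<sigma> a = 0"
    and b: "b \<in> F" "\<sigma> b = real (card F) * L"
  shows "\<exists>t. 0 \<le> t \<and> t < \<sigma> b \<and> (\<forall>f\<in>F. t < \<sigma> f \<longrightarrow> t + L \<le> \<sigma> f)"
proof (rule ccontr)
  assume "\<not> ?thesis"
  then have *: "\<exists>f\<in>F. t < \<sigma> f \<and> \<sigma> f < t + L" if "0 \<le> t" "t < \<sigma> b" for t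
    using that by (auto simp: not_le)
  \<comment> \<open>The count is strict because \<open>a\<close> already lies at level 0; at level
    \<open>card F\<close> it exceeds the number of elements.\<close>
  have "k \<le> card F \<longrightarrow> k < card {f\<in>F. \<sigma> f \<le> real k * L}" for k
  proof (induction k)
    case 0
    have "{f\<in>F. \<sigma> f \<le> 0} \<noteq> {}" using a by auto
    then show ?case using fin by (simp add: card_gt_0_iff)
  next
    case (Suc k)
    show ?case
    proof
      assume k: "Suc k \<le> card F"
      then have "real k * L < real (card F) * L" using L by (intro mult_strict_right_mono) auto
      then obtain f where f: "f \<in> F" "real k * L < \<sigma> f" "\<sigma> f < real k * L + L"
        using *[of "real k * L"] b L by auto
      have "f \<in> {f\<in>F. \<sigma> f \<le> real (Suc k) * L} - {f\<in>F. \<sigma> f \<le> real k * L}"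
        using f by (auto simp: algebra_simps)
      moreover have "{f\<in>F. \<sigma> f \<le> real k * L} \<subseteq> {f\<in>F. \<sigma> f \<le> real (Suc k) * L}"
        using L by (auto simp: algebra_simps)
      ultimately have "{f\<in>F. \<sigma> f \<le> real k * L} \<subset> {f\<in>F. \<sigma> f \<le> real (Suc k) * L}"
        by blast
      then have "card {f\<in>F. \<sigma> f \<le> real k * L} < card {f\<in>F. \<sigma> f \<le> real (Suc k) * L}"
        using fin by (intro psubset_card_mono) auto
      with Suc k show "Suc k < card {f\<in>F. \<sigma> f \<le> real (Suc k) * L}" by simp
    qed
  qed
  from this[of "card F"] show False
    using card_mono[of F "{f\<in>F. \<sigma> f \<le> real (card F) * L}"] fin by auto
qed

section \<open>The cone angle map for abstractly glued sides\<close>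

text \<open>This keeps only the combinatorics of the surface: polygons whose sides are paired by
  \<open>opp\<close>. The last assumption says that the dual graph is connected.\<close>

locale glued_sides =
  fixes F :: "'f set" and Sd :: "'s set" and face :: "'s \<Rightarrow> 'f" and opp :: "'s \<Rightarrow> 's"
    and D :: "'s \<Rightarrow> real"
  assumes finite_F: "finite F" and finite_Sd: "finite Sd"
    and face_in: "s \<in> Sd \<Longrightarrow> face s \<in> F"
    and opp_in: "s \<in> Sd \<Longrightarrow> opp s \<in> Sd"
    and opp_opp: "s \<in> Sd \<Longrightarrow> opp (opp s) = s"
    and D_opp: "s \<in> Sd \<Longrightarrow> D (opp s) = D s"
    and D_pos: "s \<in> Sd \<Longrightarrow> 0 < D s" and D_less_pi: "s \<in> Sd \<Longrightarrow> D s < pi"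
    and connected: "X \<subseteq> F \<Longrightarrow> X \<noteq> {} \<Longrightarrow> X \<noteq> F \<Longrightarrow>
      \<exists>s\<in>Sd. face s \<in> X \<and> face (opp s) \<notin> X"
begin

definition half_cone :: "('f \<Rightarrow> real) \<Rightarrow> 'f \<Rightarrow> real" where
  "half_cone \<rho> f = (\<Sum>s | s \<in> Sd \<and> face s = f. kite_angle (D s) (\<rho> (face (opp s)) - \<rho> f))"

text \<open>An edge between faces of \<open>X\<close> contributes both of its sides here, hence the
  weights \<open>D s / 2\<close> on \<open>inner X\<close> below; an edge leaving \<open>X\<close>
  contributes a single side, to \<open>border X\<close>.\<close>

definition inner :: "'f set \<Rightarrow> 's set" where
  "inner X = {s \<in> Sd. face s \<in> X \<and> face (opp s) \<in> X}"

definition border :: "'f set \<Rightarrow> 's set" where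
  "border X = {s \<in> Sd. face s \<in> X \<and> face (opp s) \<notin> X}"

lemma finite_inner [simp]: "finite (inner X)" and finite_border [simp]: "finite (border X)"
  using finite_Sd by (auto simp: inner_def border_def)

lemma sum_involution:
  assumes "A \<subseteq> Sd" and "\<And>s. s \<in> A \<Longrightarrow> opp s \<in> A"
  shows "(\<Sum>s\<in>A. g (opp s)) = (\<Sum>s\<in>A. g s)"
  using assms opp_opp by (intro sum.reindex_bij_witness[of _ opp opp]) auto

lemma sum_faces:
  assumes "X \<subseteq> F"
  shows "(\<Sum>f\<in>X. \<Sum>s | s \<in> Sd \<and> face s = f. g s) = sum g (inner X) + sum g (border X)"
proof -
  have "sum g (inner X) + sum g (border X) = sum g (inner X \<union> border X)"
    by (intro sum.union_disjoint[symmetric]) (auto simp: inner_def border_def finite_Sd)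
  also have "inner X \<union> border X = {s \<in> Sd. face s \<in> X}" by (auto simp: inner_def border_def)
  also have "sum g \<dots> = (\<Sum>f\<in>X. \<Sum>s | s \<in> {s \<in> Sd. face s \<in> X} \<and> face s = f. g s)"
    using finite_subset[OF assms finite_F] finite_Sd
    by (intro sum.group[symmetric]) auto
  also have "\<dots> = (\<Sum>f\<in>X. \<Sum>s | s \<in> Sd \<and> face s = f. g s)"
    by (intro sum.cong refl) auto
  finally show ?thesis by simp
qed

text \<open>The angles at an inner side and its opposite add up to \<open>D\<close>, which amounts
  to \<open>D / 2\<close> per side. Only the border terms still depend on
  \<open>\<rho>\<close>.\<close>

lemma sum_half_cone:
  assumes "X \<subseteq> F"
  shows "(\<Sum>f\<in>X. half_cone \<rho> f) = (\<Sum>s\<in>inner X. D s / 2) +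
    (\<Sum>s\<in>border X. kite_angle (D s) (\<rho> (face (opp s)) - \<rho> (face s)))"
proof -
  define g where "g = (\<lambda>s. kite_angle (D s) (\<rho> (face (opp s)) - \<rho> (face s)))"
  have "(\<Sum>f\<in>X. half_cone \<rho> f) = (\<Sum>f\<in>X. \<Sum>s | s \<in> Sd \<and> face s = f. g s)"
    unfolding half_cone_def g_def by (intro sum.cong) auto
  then have 1: "(\<Sum>f\<in>X. half_cone \<rho> f) = sum g (inner X) + sum g (border X)"
    using sum_faces[OF assms] by simp
  have "(\<Sum>s\<in>inner X. g (opp s)) = sum g (inner X)"
    by (rule sum_involution) (auto simp: inner_def opp_in opp_opp)
  then have "2 * sum g (inner X) = (\<Sum>s\<in>inner X. g s + g (opp s))"
    by (simp add: sum.distrib)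
  also have "\<dots> = (\<Sum>s\<in>inner X. D s)"
  proof (rule sum.cong[OF refl])
    fix s assume "s \<in> inner X"
    then have s: "s \<in> Sd" by (simp add: inner_def)
    then show "g s + g (opp s) = D s"
      using kite_angle_minus[OF D_pos D_less_pi, OF s s, of "\<rho> (face (opp s)) - \<rho> (face s)"]
      by (simp add: g_def opp_opp D_opp)
  qed
  finally have "sum g (inner X) = (\<Sum>s\<in>inner X. D s / 2)" by (simp add: sum_divide_distrib[symmetric])
  with 1 show ?thesis by (simp add: g_def)
qed

lemma inner_F: "inner F = Sd" and border_F: "border F = {}"
  by (auto simp: inner_def border_def face_in opp_in)

lemma total_half_cone: "(\<Sum>f\<in>F. half_cone \<rho> f) = (\<Sum>s\<in>Sd. D s / 2)"
  using sum_half_cone[of F \<rho>] by (simp add: inner_F border_F)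

lemma border_nonempty: "X \<subseteq> F \<Longrightarrow> X \<noteq> {} \<Longrightarrow> X \<noteq> F \<Longrightarrow> border X \<noteq> {}"
  using connected[of X] by (auto simp: border_def)

text \<open>Each border angle stays below \<open>D\<close>, and connectedness provides at least one
  border side, which makes the inequality strict.\<close>

lemma half_cone_sum_less:
  assumes "X \<subseteq> F" "X \<noteq> {}" "X \<noteq> F"
  shows "(\<Sum>f\<in>X. half_cone \<rho> f) < (\<Sum>s\<in>inner X. D s / 2) + (\<Sum>s\<in>border X. D s)"
  unfolding sum_half_cone[OF assms(1)]
  using border_nonempty[OF assms]
  by (intro add_strict_left_mono sum_strict_mono)
     (auto simp: border_def D_pos D_less_pi kite_angle_less finite_Sd)

lemma sum_border_compl:
  assumes "X \<subseteq> F"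
  shows "(\<Sum>s\<in>border (F - X). D s) = (\<Sum>s\<in>border X. D s)"
  using assms
  by (intro sum.reindex_bij_witness[of _ opp opp])
     (auto simp: border_def face_in opp_in opp_opp D_opp)

text \<open>An edge between \<open>X\<close> and its complement has one side in each of the two
  borders; together these weigh \<open>D\<close>.\<close>

lemma sum_inner_compl:
  assumes "X \<subseteq> F"
  shows "(\<Sum>s\<in>Sd. D s / 2) = (\<Sum>s\<in>inner X. D s / 2) + (\<Sum>s\<in>inner (F - X). D s / 2)
    + (\<Sum>s\<in>border X. D s)"
proof -
  have "Sd = (inner X \<union> inner (F - X)) \<union> (border X \<union> border (F - X))"
    by (auto simp: inner_def border_def face_in opp_in)
  then have "(\<Sum>s\<in>Sd. D s / 2) =
      (\<Sum>s\<in>(inner X \<union> inner (F - X)) \<union> (border X \<union> border (F - X)). D s / 2)" by simp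
  also have "\<dots> = (\<Sum>s\<in>inner X \<union> inner (F - X). D s / 2) + (\<Sum>s\<in>border X \<union> border (F - X). D s / 2)"
    by (intro sum.union_disjoint) (auto simp: inner_def border_def finite_Sd)
  also have "(\<Sum>s\<in>inner X \<union> inner (F - X). D s / 2) =
      (\<Sum>s\<in>inner X. D s / 2) + (\<Sum>s\<in>inner (F - X). D s / 2)"
    by (intro sum.union_disjoint) (auto simp: inner_def finite_Sd)
  also have "(\<Sum>s\<in>border X \<union> border (F - X). D s / 2) =
      (\<Sum>s\<in>border X. D s / 2) + (\<Sum>s\<in>border (F - X). D s / 2)"
    by (intro sum.union_disjoint) (auto simp: border_def finite_Sd)
  finally show ?thesis
    using sum_border_compl[OF assms] by (simp add: sum_divide_distrib[symmetric])
qed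

section \<open>Existence by Perron's method\<close>

text \<open>Larger neighbouring circles enlarge the angles at \<open>f\<close>. This comparison is
  what makes suprema of subsolutions work.\<close>

lemma half_cone_mono:
  assumes "\<And>f'. \<rho> f' \<le> \<sigma> f'" and "\<rho> f = \<sigma> f"
  shows "half_cone \<rho> f \<le> half_cone \<sigma> f"
  unfolding half_cone_def using assms
  by (intro sum_mono kite_angle_mono) (auto simp: D_pos D_less_pi)

lemma continuous_half_cone: "isCont (\<lambda>t. half_cone (\<rho>(f := t)) f) t"
proof -
  have "isCont (\<lambda>t. kite_angle (D s) ((\<rho>(f := t)) (face (opp s)) - (\<rho>(f := t)) f)) t"
    if "s \<in> Sd" for s
  \<comment> \<open>If a face is glued to itself along \<open>s\<close>, the difference of
    logarithmic radii is constantly 0.\<close>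
  proof (cases "face (opp s) = f")
    case False
    have "isCont (\<lambda>t. kite_angle (D s) (\<rho> (face (opp s)) - t)) t"
      by (rule isCont_o2[OF _ continuous_kite_angle[OF D_pos[OF that] D_less_pi[OF that]]])
         (intro continuous_intros)
    with False show ?thesis by simp
  qed simp
  then show ?thesis unfolding half_cone_def by (intro continuous_sum) auto
qed

text \<open>The solution is the pointwise supremum of the subsolutions in the box.\<close>

lemma perron_solution:
  assumes M: "0 \<le> M"
  shows "\<exists>\<sigma>. (\<forall>f. 0 \<le> \<sigma> f \<and> \<sigma> f \<le> M) \<and> (\<forall>f. \<sigma> f > 0 \<longrightarrow> \<phi> f \<le> half_cone \<sigma> f) \<and>
    (\<forall>f. \<sigma> f < M \<longrightarrow> half_cone \<sigma> f \<le> \<phi> f)"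
proof -
  \<comment> \<open>Subsolutions satisfy the inequality only off the lower obstacle 0, so the zero
    function is one vacuously.\<close>
  define A where "A = {\<rho>. (\<forall>f. 0 \<le> \<rho> f \<and> \<rho> f \<le> M) \<and> (\<forall>f. \<rho> f > 0 \<longrightarrow> \<phi> f \<le> half_cone \<rho> f)}"
  define \<sigma> where "\<sigma> = (\<lambda>f. SUP \<rho>\<in>A. \<rho> f)"
  have zero: "(\<lambda>_. 0) \<in> A" using M by (auto simp: A_def)
  have bdd: "bdd_above ((\<lambda>\<rho>. \<rho> f) ` A)" for f by (auto simp: A_def intro!: bdd_aboveI[of _ M])
  have upper: "\<rho> f \<le> \<sigma> f" if "\<rho> \<in> A" for \<rho> f
    unfolding \<sigma>_def using that bdd by (intro cSUP_upper) auto
  have le_M: "\<sigma> f \<le> M" for f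
    unfolding \<sigma>_def using zero by (intro cSUP_least) (auto simp: A_def)
  have ge_0: "0 \<le> \<sigma> f" for f using upper[OF zero] by simp
  have sub: "\<phi> f \<le> half_cone \<sigma> f" if "\<sigma> f > 0" for f
  proof (rule ccontr)
    assume "\<not> ?thesis"
    \<comment> \<open>A strict failure persists when the value at \<open>f\<close> alone is lowered
      slightly. Some subsolution comes that close to the supremum at \<open>f\<close>, and raising
      its other values to those of \<open>\<sigma>\<close> can only increase the cone angle at
      \<open>f\<close>.\<close>
    then have "half_cone (\<sigma>(f := \<sigma> f)) f < \<phi> f" by simp
    then have "\<forall>\<^sub>F t in nhds (\<sigma> f). half_cone (\<sigma>(f := t)) f < \<phi> f"
      using continuous_half_cone[where \<rho> = \<sigma> and f = f and t = "\<sigma> f"]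
      by (intro order_tendstoD) (auto simp: isCont_def tendsto_nhds_iff tendsto_at_iff_tendsto_nhds)
    then obtain \<epsilon> where \<epsilon>: "\<epsilon> > 0" "\<And>t. dist t (\<sigma> f) < \<epsilon> \<Longrightarrow> half_cone (\<sigma>(f := t)) f < \<phi> f"
      by (auto simp: eventually_nhds_metric)
    \<comment> \<open>The bound 0 ensures \<open>0 < \<rho> f\<close>, without which membership in
      \<open>A\<close> says nothing about the cone angle at \<open>f\<close>.\<close>
    define u where "u = max 0 (\<sigma> f - \<epsilon>)"
    have "u < \<sigma> f" using that \<epsilon> by (auto simp: u_def)
    then have "u < (SUP \<rho>\<in>A. \<rho> f)" unfolding \<sigma>_def .
    moreover have "A \<noteq> {}" using zero by blast
    ultimately obtain \<rho> where \<rho>: "\<rho> \<in> A" "u < \<rho> f"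
      using less_cSUP_iff[OF _ bdd] by blast
    then have \<rho>_f: "0 < \<rho> f" "\<sigma> f - \<epsilon> < \<rho> f" by (auto simp: u_def)
    have "\<phi> f \<le> half_cone \<rho> f" using \<rho>(1) \<rho>_f(1) by (auto simp: A_def)
    also have "\<dots> \<le> half_cone (\<sigma>(f := \<rho> f)) f"
      using upper[OF \<rho>(1)] by (intro half_cone_mono) auto
    also have "\<dots> < \<phi> f" using \<rho>_f upper[OF \<rho>(1), of f] by (intro \<epsilon>) (auto simp: dist_real_def)
    finally show False by simp
  qed
  have super: "half_cone \<sigma> f \<le> \<phi> f" if "\<sigma> f < M" for f
  proof (rule ccontr)
    assume "\<not> ?thesis"
    \<comment> \<open>With room left below \<open>M\<close>, raising \<open>\<sigma>\<close>
      slightly at \<open>f\<close> gives another subsolution, at \<open>f\<close> by continuity and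
      elsewhere by monotonicity. It would exceed the supremum.\<close>
    then have "half_cone (\<sigma>(f := \<sigma> f)) f > \<phi> f" by simp
    then have "\<forall>\<^sub>F t in nhds (\<sigma> f). half_cone (\<sigma>(f := t)) f > \<phi> f"
      using continuous_half_cone[where \<rho> = \<sigma> and f = f and t = "\<sigma> f"]
      by (intro order_tendstoD) (auto simp: isCont_def tendsto_nhds_iff tendsto_at_iff_tendsto_nhds)
    then obtain \<epsilon> where \<epsilon>: "\<epsilon> > 0" "\<And>t. dist t (\<sigma> f) < \<epsilon> \<Longrightarrow> half_cone (\<sigma>(f := t)) f > \<phi> f"
      by (auto simp: eventually_nhds_metric)
    define t where "t = min M (\<sigma> f + \<epsilon> / 2)"
    have t: "t > \<sigma> f" "t \<le> M" "half_cone (\<sigma>(f := t)) f > \<phi> f"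
      using \<epsilon> that by (auto simp: t_def dist_real_def intro!: \<epsilon>(2))
    have "\<phi> g \<le> half_cone (\<sigma>(f := t)) g" if "(\<sigma>(f := t)) g > 0" for g
    proof (cases "g = f")
      case False
      then have "\<phi> g \<le> half_cone \<sigma> g" using that by (intro sub) auto
      also have "\<dots> \<le> half_cone (\<sigma>(f := t)) g" using t False by (intro half_cone_mono) auto
      finally show ?thesis .
    qed (use t in auto)
    then have "\<sigma>(f := t) \<in> A" using t ge_0 le_M order.trans[OF ge_0 less_imp_le[OF t(1)]]
      by (auto simp: A_def)
    from upper[OF this, of f] t show False by simp
  qed
  show ?thesis using ge_0 le_M sub super by (intro exI[of _ \<sigma>]) auto
qed

text \<open>Angles looking down across a gap of length \<open>L\<close> tend to 0, so each strict
  inequality survives for large \<open>L\<close>. There are finitely many sets \<open>X\<close>,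
  hence one \<open>L\<close> serves them all.\<close>

lemma eventually_kite_gap:
  assumes "\<And>X. X \<subseteq> F \<Longrightarrow> X \<noteq> {} \<Longrightarrow> X \<noteq> F \<Longrightarrow> (\<Sum>s\<in>inner X. D s / 2) < (\<Sum>f\<in>X. \<phi> f)"
  shows "\<forall>\<^sub>F L in at_top. \<forall>X\<in>{X. X \<subseteq> F \<and> X \<noteq> {} \<and> X \<noteq> F}.
    (\<Sum>s\<in>inner X. D s / 2) + (\<Sum>s\<in>border X. kite_angle (D s) (- L)) < (\<Sum>f\<in>X. \<phi> f)"
proof (rule eventually_ball_finite)
  show "finite {X. X \<subseteq> F \<and> X \<noteq> {} \<and> X \<noteq> F}"
    using finite_F by (auto intro: finite_subset[of _ "Pow F"])
  show "\<forall>X\<in>{X. X \<subseteq> F \<and> X \<noteq> {} \<and> X \<noteq> F}. \<forall>\<^sub>F L in at_top.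
    (\<Sum>s\<in>inner X. D s / 2) + (\<Sum>s\<in>border X. kite_angle (D s) (- L)) < (\<Sum>f\<in>X. \<phi> f)"
  proof
    fix X assume X: "X \<in> {X. X \<subseteq> F \<and> X \<noteq> {} \<and> X \<noteq> F}"
    have "((\<lambda>L. \<Sum>s\<in>border X. kite_angle (D s) (- L)) \<longlongrightarrow> (\<Sum>s\<in>border X. 0)) at_top"
      by (intro tendsto_sum kite_angle_at_bot) (auto simp: border_def D_pos D_less_pi)
    then have "((\<lambda>L. (\<Sum>s\<in>inner X. D s / 2) + (\<Sum>s\<in>border X. kite_angle (D s) (- L)))
        \<longlongrightarrow> (\<Sum>s\<in>inner X. D s / 2) + 0) at_top"
      by (intro tendsto_intros) auto
    then show "\<forall>\<^sub>F L in at_top.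
      (\<Sum>s\<in>inner X. D s / 2) + (\<Sum>s\<in>border X. kite_angle (D s) (- L)) < (\<Sum>f\<in>X. \<phi> f)"
      using assms X by (intro order_tendstoD) auto
  qed
qed

text \<open>Perron's method gives one inequality off each obstacle; the prescribed total turns
  one-sided inequalities into equations.\<close>

lemma ex_half_cone:
  assumes total: "(\<Sum>f\<in>F. \<phi> f) = (\<Sum>s\<in>Sd. D s / 2)"
    and less: "\<And>X. X \<subseteq> F \<Longrightarrow> X \<noteq> {} \<Longrightarrow> X \<noteq> F \<Longrightarrow>
      (\<Sum>f\<in>X. \<phi> f) < (\<Sum>s\<in>inner X. D s / 2) + (\<Sum>s\<in>border X. D s)"
  shows "\<exists>\<rho>. \<forall>f\<in>F. half_cone \<rho> f = \<phi> f"
proof -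
  \<comment> \<open>The upper bound for the complement of \<open>X\<close>, subtracted from the
    total, becomes a lower bound for \<open>X\<close>.\<close>
  have "(\<Sum>s\<in>inner X. D s / 2) < (\<Sum>f\<in>X. \<phi> f)" if X: "X \<subseteq> F" "X \<noteq> {}" "X \<noteq> F" for X
  proof -
    have "(\<Sum>f\<in>F - X. \<phi> f) < (\<Sum>s\<in>inner (F - X). D s / 2) + (\<Sum>s\<in>border (F - X). D s)"
      using X by (intro less) auto
    moreover have "(\<Sum>f\<in>F. \<phi> f) = (\<Sum>f\<in>F - X. \<phi> f) + (\<Sum>f\<in>X. \<phi> f)"
      using X finite_F by (intro sum.subset_diff) auto
    ultimately show ?thesis using sum_inner_compl[OF X(1)] sum_border_compl[OF X(1)] total by simp
  qed
  from eventually_kite_gap[OF this]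
  have "\<forall>\<^sub>F L in at_top. L > 0 \<and> (\<forall>X\<in>{X. X \<subseteq> F \<and> X \<noteq> {} \<and> X \<noteq> F}.
    (\<Sum>s\<in>inner X. D s / 2) + (\<Sum>s\<in>border X. kite_angle (D s) (- L)) < (\<Sum>f\<in>X. \<phi> f))"
    by (intro eventually_conj eventually_gt_at_top)
  then obtain L where L: "L > 0" and gap: "\<And>X. X \<subseteq> F \<Longrightarrow> X \<noteq> {} \<Longrightarrow> X \<noteq> F \<Longrightarrow>
    (\<Sum>s\<in>inner X. D s / 2) + (\<Sum>s\<in>border X. kite_angle (D s) (- L)) < (\<Sum>f\<in>X. \<phi> f)"
    unfolding eventually_at_top_linorder by blast
  define M where "M = real (card F) * L"
  have "M \<ge> 0" using L by (simp add: M_def)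
  from perron_solution[OF this, of \<phi>] obtain \<sigma> where \<sigma>: "\<And>f. 0 \<le> \<sigma> f" "\<And>f. \<sigma> f \<le> M"
    "\<And>f. \<sigma> f > 0 \<Longrightarrow> \<phi> f \<le> half_cone \<sigma> f" "\<And>f. \<sigma> f < M \<Longrightarrow> half_cone \<sigma> f \<le> \<phi> f"
    by blast
  have tot: "(\<Sum>f\<in>F. \<phi> f) = (\<Sum>f\<in>F. half_cone \<sigma> f)" using total total_half_cone by simp
  \<comment> \<open>Either the lower obstacle is inactive, or the upper one is, or both are
    active.\<close>
  consider "\<forall>f\<in>F. \<sigma> f > 0" | "\<forall>f\<in>F. \<sigma> f < M" | a b where "a \<in> F" "\<sigma> a = 0" "b \<in> F" "\<sigma> b = M"
    using \<sigma>(1,2) by (meson antisym not_less)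
  then show ?thesis
  proof cases
    case 1
    have "\<phi> f = half_cone \<sigma> f" if "f \<in> F" for f
      by (rule sum_mono_inv[OF tot _ that finite_F]) (use 1 \<sigma>(3) in auto)
    then show ?thesis by auto
  next
    case 2
    have "half_cone \<sigma> f = \<phi> f" if "f \<in> F" for f
      by (rule sum_mono_inv[OF tot[symmetric] _ that finite_F]) (use 2 \<sigma>(4) in auto)
    then show ?thesis by auto
  next
    case 3
    \<comment> \<open>The height \<open>M = card F * L\<close> of the box is what the pigeonhole
      argument needs for a gap of length \<open>L\<close>.\<close>
    then obtain t where t: "0 \<le> t" "t < \<sigma> b" "\<forall>f\<in>F. t < \<sigma> f \<longrightarrow> t + L \<le> \<sigma> f"
      using gap_in_values[OF finite_F L, of a \<sigma> b] by (auto simp: M_def)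
    define X where "X = {f\<in>F. t < \<sigma> f}"
    have "a \<notin> X" "b \<in> X" using 3 t by (auto simp: X_def)
    moreover have "X \<subseteq> F" by (auto simp: X_def)
    ultimately have X: "X \<subseteq> F" "X \<noteq> {}" "X \<noteq> F" using 3 by blast+
    \<comment> \<open>Faces above the gap are off the lower obstacle, and every border angle of
      \<open>X\<close> looks down across the gap.\<close>
    have "(\<Sum>f\<in>X. \<phi> f) \<le> (\<Sum>f\<in>X. half_cone \<sigma> f)"
      using t by (intro sum_mono \<sigma>(3)) (auto simp: X_def)
    also have "\<dots> = (\<Sum>s\<in>inner X. D s / 2) +
        (\<Sum>s\<in>border X. kite_angle (D s) (\<sigma> (face (opp s)) - \<sigma> (face s)))"
      by (rule sum_half_cone[OF X(1)])
    also have "\<dots> \<le> (\<Sum>s\<in>inner X. D s / 2) + (\<Sum>s\<in>border X. kite_angle (D s) (- L))"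
    proof (intro add_left_mono sum_mono kite_angle_mono)
      fix s assume s: "s \<in> border X"
      then show "0 < D s" "D s < pi" by (auto simp: border_def D_pos D_less_pi)
      from s have "\<not> t < \<sigma> (face (opp s))" "t + L \<le> \<sigma> (face s)"
        using t(3) by (auto simp: border_def X_def face_in opp_in)
      then show "\<sigma> (face (opp s)) - \<sigma> (face s) \<le> - L" by linarith
    qed
    also have "\<dots> < (\<Sum>f\<in>X. \<phi> f)" by (rule gap[OF X])
    finally show ?thesis by simp
  qed
qed

text \<open>Maximum principle: where \<open>\<sigma> - \<rho>\<close> attains its maximum
  \<open>m\<close>, no angle is larger for \<open>\<sigma>\<close> than for \<open>\<rho>\<close>,
  and one at a side leaving the maximum set is strictly smaller. Equal cone angles therefore force
  this set to be all of \<open>F\<close>.\<close>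

lemma half_cone_unique:
  assumes eq: "\<And>f. f \<in> F \<Longrightarrow> half_cone \<rho> f = half_cone \<sigma> f"
  shows "\<exists>c. \<forall>f\<in>F. \<sigma> f = \<rho> f + c"
proof (cases "F = {}")
  case False
  define m where "m = Max ((\<lambda>f. \<sigma> f - \<rho> f) ` F)"
  define X where "X = {f\<in>F. \<sigma> f - \<rho> f = m}"
  have le: "\<sigma> f - \<rho> f \<le> m" if "f \<in> F" for f unfolding m_def using that finite_F by auto
  have "m \<in> (\<lambda>f. \<sigma> f - \<rho> f) ` F" unfolding m_def using False finite_F by (intro Max_in) auto
  then have ne: "X \<noteq> {}" by (auto simp: X_def)
  have "X = F"
  proof (rule ccontr)
    assume "X \<noteq> F"
    then obtain s where s: "s \<in> Sd" "face s \<in> X" "face (opp s) \<notin> X"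
      using connected[OF _ ne] by (auto simp: X_def)
    have "half_cone \<sigma> (face s) < half_cone \<rho> (face s)"
      unfolding half_cone_def
    proof (rule sum_strict_mono_ex1)
      show "finite {s' \<in> Sd. face s' = face s}" using finite_Sd by auto
      show "\<forall>s'\<in>{s' \<in> Sd. face s' = face s}. kite_angle (D s') (\<sigma> (face (opp s')) - \<sigma> (face s))
         \<le> kite_angle (D s') (\<rho> (face (opp s')) - \<rho> (face s))"
      proof (intro ballI kite_angle_mono)
        fix s' assume s': "s' \<in> {s' \<in> Sd. face s' = face s}"
        then show "0 < D s'" "D s' < pi" by (auto simp: D_pos D_less_pi)
        have "face (opp s') \<in> F" using s' by (auto simp: face_in opp_in)
        from le[OF this] s(2)
        show "\<sigma> (face (opp s')) - \<sigma> (face s) \<le> \<rho> (face (opp s')) - \<rho> (face s)"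
          by (simp add: X_def)
      qed
      have "face (opp s) \<in> F" using s by (auto simp: face_in opp_in)
      from le[OF this] s
      have "\<sigma> (face (opp s)) - \<sigma> (face s) < \<rho> (face (opp s)) - \<rho> (face s)"
        by (auto simp: X_def \<open>face (opp s) \<in> F\<close>)
      from kite_angle_strict_mono[OF D_pos D_less_pi this, OF s(1) s(1)]
      show "\<exists>s'\<in>{s' \<in> Sd. face s' = face s}. kite_angle (D s') (\<sigma> (face (opp s')) - \<sigma> (face s))
         < kite_angle (D s') (\<rho> (face (opp s')) - \<rho> (face s))"
        using s(1) by auto
    qed
    with eq[of "face s"] face_in[OF s(1)] show False by simp
  qed
  then have "\<sigma> f = \<rho> f + m" if "f \<in> F" for f
  proof -
    from that have "f \<in> X" by (simp add: \<open>X = F\<close>)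
    then show ?thesis by (simp add: X_def)
  qed
  then show ?thesis by blast
qed auto

end

section \<open>Euclidean kites\<close>

lemma angle_at_commute: "angle_at A B C = angle_at C B A"
  by (simp add: angle_at_def inner_commute mult.commute)

text \<open>Cauchy-Schwarz puts the quotient into the domain of \<open>arccos\<close>; for a zero
  vector both sides vanish.\<close>

lemma inner_eq_cos_angle_at:
  "(A - B) \<bullet> (C - B) = norm (A - B) * norm (C - B) * cos (angle_at A B C)"
proof (cases "A = B \<or> C = B")
  case False
  have "\<bar>(A - B) \<bullet> (C - B)\<bar> \<le> norm (A - B) * norm (C - B)" by (rule Cauchy_Schwarz_ineq2)
  with False have "\<bar>((A - B) \<bullet> (C - B)) / (norm (A - B) * norm (C - B))\<bar> \<le> 1"
    by (simp add: divide_simps)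
  then have "cos (angle_at A B C) = ((A - B) \<bullet> (C - B)) / (norm (A - B) * norm (C - B))"
    unfolding angle_at_def by (intro cos_arccos_abs)
  with False show ?thesis by simp
qed auto

text \<open>The law of cosines; the last term is positive in form because the enclosed angle is
  \<open>pi - D\<close>.\<close>

lemma dist_centres:
  assumes r: "dist O1 P = r1" "dist O2 P = r2" and ang: "angle_at O1 P O2 = pi - D"
  shows "(dist O1 O2)\<^sup>2 = r1\<^sup>2 + r2\<^sup>2 + 2 * r1 * r2 * cos D"
proof -
  have "(O1 - P) \<bullet> (O2 - P) = - r1 * r2 * cos D"
    using inner_eq_cos_angle_at[of O1 P O2] r by (simp add: ang dist_norm cos_diff)
  moreover have "(dist O1 O2)\<^sup>2 = (norm (O1 - P))\<^sup>2 + (norm (O2 - P))\<^sup>2 - 2 * ((O1 - P) \<bullet> (O2 - P))"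
    using dot_norm_neg[of "O1 - P" "O2 - P"] by (simp add: dist_norm field_simps)
  ultimately show ?thesis using r by (simp add: dist_norm)
qed

text \<open>The expression is the squared modulus of r1 + r2 * cis D, whose imaginary part is
  nonzero.\<close>

lemma centres_distance_pos:
  fixes r1 r2 D :: real
  assumes "0 < D" "D < pi" "0 < r1" "0 < r2"
  shows "0 < r1\<^sup>2 + r2\<^sup>2 + 2 * r1 * r2 * cos D"
proof -
  have s: "sin D > 0" using assms sin_gt_zero by auto
  have "r1\<^sup>2 + r2\<^sup>2 + 2 * r1 * r2 * cos D = (r1 + r2 * cos D)\<^sup>2 + r2\<^sup>2 * (sin D)\<^sup>2"
    unfolding sin_squared_eq by (simp add: power2_eq_square algebra_simps)
  moreover have "r2\<^sup>2 * (sin D)\<^sup>2 > 0" using s assms by simp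
  ultimately show ?thesis by (simp add: add_nonneg_pos)
qed

text \<open>The cosine and sine of the angle at \<open>O1\<close> are computed from inner products;
  they satisfy the law of sines, so \<open>kite_angle_unique\<close> applies.\<close>

lemma angle_at_centre:
  assumes D: "0 < D" "D < pi" and pos: "0 < r1" "0 < r2"
    and r: "dist O1 P = r1" "dist O2 P = r2" and ang: "angle_at O1 P O2 = pi - D"
  shows "angle_at P O1 O2 = kite_angle D (ln r2 - ln r1)"
proof -
  define d where "d = dist O1 O2"
  have d2: "d\<^sup>2 = r1\<^sup>2 + r2\<^sup>2 + 2 * r1 * r2 * cos D"
    unfolding d_def by (rule dist_centres[OF r ang])
  have "d \<noteq> 0" using centres_distance_pos[OF D pos] d2 by auto
  then have d: "d > 0" by (simp add: d_def)
  have s: "sin D > 0" using D sin_gt_zero by auto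
  define c where "c = (r1 + r2 * cos D) / d"
  have "(O1 - P) \<bullet> (O2 - P) = - r1 * r2 * cos D"
    using inner_eq_cos_angle_at[of O1 P O2] r by (simp add: ang dist_norm cos_diff)
  moreover have "(O1 - P) \<bullet> (O1 - P) = r1\<^sup>2"
    using r by (simp add: dist_norm flip: power2_norm_eq_inner)
  moreover have "(P - O1) \<bullet> (O2 - O1) = (O1 - P) \<bullet> (O1 - P) - (O1 - P) \<bullet> (O2 - P)"
    by (simp add: algebra_simps inner_diff_left inner_diff_right inner_commute)
  ultimately have "(P - O1) \<bullet> (O2 - O1) = r1 * (r1 + r2 * cos D)"
    by (simp add: power2_eq_square algebra_simps)
  moreover have "norm (P - O1) = r1" "norm (O2 - O1) = d"
    using r by (simp_all add: d_def dist_norm norm_minus_commute)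
  ultimately have t: "angle_at P O1 O2 = arccos c" using pos by (simp add: angle_at_def c_def)
  have "1 - c\<^sup>2 = (d\<^sup>2 - (r1 + r2 * cos D)\<^sup>2) / d\<^sup>2" using d by (simp add: c_def power_divide field_simps)
  also have "d\<^sup>2 - (r1 + r2 * cos D)\<^sup>2 = r2\<^sup>2 * (1 - (cos D)\<^sup>2)"
    using d2 by (simp add: power2_eq_square algebra_simps)
  also have "\<dots> / d\<^sup>2 = (r2 * sin D / d)\<^sup>2"
    by (simp add: sin_squared_eq power_mult_distrib power_divide)
  finally have c2: "1 - c\<^sup>2 = (r2 * sin D / d)\<^sup>2" .
  have "(r2 * sin D / d)\<^sup>2 > 0" using pos s d by simp
  with c2 have "c\<^sup>2 < 1" by linarith
  then have c: "- 1 < c" "c < 1" by (auto simp: abs_square_less_1)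
  have sin_t: "sin (arccos c) = r2 * sin D / d"
    using c c2 pos s d by (simp add: sin_arccos real_sqrt_abs abs_of_pos)
  have "sin (D - arccos c) = sin D * c - cos D * (r2 * sin D / d)"
    using c by (simp add: sin_diff sin_t cos_arccos)
  also have "\<dots> = r1 * sin D / d" using d by (simp add: c_def field_simps)
  also have "\<dots> = exp (- (ln r2 - ln r1)) * sin (arccos c)"
    using pos by (simp add: sin_t exp_diff)
  finally have "sin (D - arccos c) = exp (- (ln r2 - ln r1)) * sin (arccos c)" .
  then have "kite_angle D (ln r2 - ln r1) = arccos c"
    using arccos_lt_bounded[OF c] by (intro kite_angle_unique D) auto
  with t show ?thesis by simp
qed

text \<open>Coordinates of the model kite: the centres lie on the real axis and the corners on the
  imaginary axis at height \<open>a\<close> and \<open>- a\<close>; \<open>h\<close> stands for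
  either corner.\<close>

lemma angle_at_corner:
  assumes D: "0 < D" "D < pi" and pos: "0 < r1" "0 < r2"
    and t: "t1 + t2 = D" and a: "r1 * sin t1 = a" "r2 * sin t2 = a" and h: "h = a \<or> h = - a"
  shows "dist (Complex (- r1 * cos t1) 0) (Complex 0 h) = r1"
    and "dist (Complex (r2 * cos t2) 0) (Complex 0 h) = r2"
    and "angle_at (Complex (- r1 * cos t1) 0) (Complex 0 h) (Complex (r2 * cos t2) 0) = pi - D"
proof -
  have h2: "h\<^sup>2 = a\<^sup>2" "h * h = a * a" using h by auto
  have n: "sqrt ((r * cos t)\<^sup>2 + (r * sin t)\<^sup>2) = r" if "0 < r" for r t :: real
  proof -
    have "(r * cos t)\<^sup>2 + (r * sin t)\<^sup>2 = r\<^sup>2 * ((cos t)\<^sup>2 + (sin t)\<^sup>2)"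
      by (simp only: power_mult_distrib distrib_left)
    with that show ?thesis by (simp only: sin_cos_squared_add2) simp
  qed
  show n1: "dist (Complex (- r1 * cos t1) 0) (Complex 0 h) = r1"
    using n[OF pos(1), of t1] by (simp add: dist_norm cmod_def h2 flip: a(1))
  show n2: "dist (Complex (r2 * cos t2) 0) (Complex 0 h) = r2"
    using n[OF pos(2), of t2] by (simp add: dist_norm cmod_def h2 flip: a(2))
  have "(Complex (- r1 * cos t1) 0 - Complex 0 h) \<bullet> (Complex (r2 * cos t2) 0 - Complex 0 h)
    = - (r1 * cos t1) * (r2 * cos t2) + h * h"
    by (simp add: inner_complex_def)
  also have "h * h = (r1 * sin t1) * (r2 * sin t2)" using a h2 by simp
  also have "- (r1 * cos t1) * (r2 * cos t2) + (r1 * sin t1) * (r2 * sin t2) =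
    r1 * r2 * cos (pi - (t1 + t2))"
    by (simp add: cos_diff cos_add algebra_simps)
  finally show "angle_at (Complex (- r1 * cos t1) 0) (Complex 0 h) (Complex (r2 * cos t2) 0) = pi - D"
    using n1 n2 pos D by (simp add: angle_at_def dist_norm t arccos_minus arccos_cos)
qed

text \<open>The common value \<open>r1 * sin t1\<close> is half the length of the common chord, and
  it serves as the height of the corners in the model kite.\<close>

lemma kite_law_of_sines:
  assumes D: "0 < D" "D < pi" and pos: "0 < r1" "0 < r2"
  defines "t1 \<equiv> kite_angle D (ln r2 - ln r1)" and "t2 \<equiv> kite_angle D (ln r1 - ln r2)"
  shows "r1 * sin t1 = r2 * sin t2" and "t1 + t2 = D" and "0 < sin t1"
proof -
  show "0 < sin t1" using kite_angle_pos kite_angle_less_pi by (simp add: t1_def sin_gt_zero)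
  show t: "t1 + t2 = D" using kite_angle_minus[OF D, of "ln r2 - ln r1"] by (simp add: t1_def t2_def)
  have "sin (D - t1) = exp (- (ln r2 - ln r1)) * sin t1" unfolding t1_def by (rule sin_kite_angle[OF D])
  moreover have "D - t1 = t2" using t by simp
  ultimately show "r1 * sin t1 = r2 * sin t2"
    using pos by (simp add: exp_diff exp_minus field_simps)
qed

text \<open>Circles around 0 and 1 meet in at most two points, which are mirror images in the real
  axis.\<close>

lemma eq_or_eq_cnj:
  assumes "norm v = norm w" and "norm (v - 1) = norm (w - 1)"
  shows "v = w \<or> v = cnj w"
proof -
  have 1: "(Re v)\<^sup>2 + (Im v)\<^sup>2 = (Re w)\<^sup>2 + (Im w)\<^sup>2"
    using assms(1) by (simp add: cmod_def)
  have "(Re v - 1)\<^sup>2 + (Im v)\<^sup>2 = (Re w - 1)\<^sup>2 + (Im w)\<^sup>2"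
    using assms(2) by (simp add: cmod_def)
  with 1 have re: "Re v = Re w" by (simp add: power2_eq_square algebra_simps)
  with 1 have "Im v = Im w \<or> Im v = - Im w" by (simp add: power2_eq_iff)
  with re show ?thesis by (auto simp: complex_eq_iff)
qed

text \<open>Affine maps \<open>k\<close> and \<open>k'\<close> normalise both kites so that the
  centres become 0 and 1. The corners then agree up to conjugation, and \<open>T\<close> is obtained
  by going back through \<open>k'\<close>.\<close>

lemma kite_similarity:
  fixes O1 O2 P Q O1' O2' P' Q' :: complex
  assumes c: "0 < c" and ne: "O1 \<noteq> O2" "P \<noteq> Q" "P' \<noteq> Q'"
    and eq: "dist O1 P = dist O1 Q" "dist O2 P = dist O2 Q"
    and d: "dist O1' O2' = c * dist O1 O2"
      "dist O1' P' = c * dist O1 P" "dist O2' P' = c * dist O2 P"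
      "dist O1' Q' = c * dist O1 Q" "dist O2' Q' = c * dist O2 Q"
  shows "\<exists>T. (\<forall>x y. dist (T x) (T y) = c * dist x y) \<and>
    T O1 = O1' \<and> T O2 = O2' \<and> T P = P' \<and> T Q = Q'"
proof -
  define k where "k = (\<lambda>x. (x - O1) / (O2 - O1))"
  define k' where "k' = (\<lambda>x. (x - O1') / (O2' - O1'))"
  have ne': "O1' \<noteq> O2'" using d(1) c ne(1) by auto
  have dk: "dist x y = dist O1 O2 * norm (k x - k y)" for x y
    using ne by (simp add: k_def dist_norm norm_minus_commute norm_divide diff_divide_distrib[symmetric])
  have dk': "dist x y = dist O1' O2' * norm (k' x - k' y)" for x y
    using ne' by (simp add: k'_def dist_norm norm_minus_commute norm_divide diff_divide_distrib[symmetric])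
  have k01: "k O1 = 0" "k O2 = 1" "k' O1' = 0" "k' O2' = 1" using ne ne' by (auto simp: k_def k'_def)
  have pos: "dist O1 O2 > 0" using ne by simp
  have nk: "norm (k x) = dist O1 x / dist O1 O2" "norm (k x - 1) = dist O2 x / dist O1 O2" for x
    using dk[of O1 x] dk[of O2 x] pos k01 by (simp_all add: norm_minus_commute)
  have nk': "norm (k' x) = dist O1' x / dist O1' O2'" "norm (k' x - 1) = dist O2' x / dist O1' O2'" for x
    using dk'[of O1' x] dk'[of O2' x] ne' k01 by (simp_all add: norm_minus_commute)
  have "k P \<noteq> k Q" "k' P' \<noteq> k' Q'" using ne ne' by (auto simp: k_def k'_def)
  moreover have "k Q = k P \<or> k Q = cnj (k P)" using eq by (intro eq_or_eq_cnj) (simp_all add: nk)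
  moreover have "k' P' = k P \<or> k' P' = cnj (k P)"
    using c by (intro eq_or_eq_cnj) (simp_all add: nk nk' d)
  moreover have "k' Q' = k Q \<or> k' Q' = cnj (k Q)"
    using c by (intro eq_or_eq_cnj) (simp_all add: nk nk' d)
  \<comment> \<open>Distinctness of the corners makes them conjugate to each other in both
    normalised kites, so the same choice of identity or conjugation fits \<open>P\<close> and
    \<open>Q\<close>.\<close>
  ultimately obtain j where j: "j = id \<or> j = cnj" "k' P' = j (k P)" "k' Q' = j (k Q)"
    by (metis complex_cnj_cnj id_apply)
  define T where "T = (\<lambda>x. O1' + (O2' - O1') * j (k x))"
  have kT: "k' (T x) = j (k x)" for x using ne' by (simp add: k'_def T_def)
  have inj: "x = y" if "k' x = k' y" for x y using that ne' by (simp add: k'_def)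
  have "norm (j z - j w) = norm (z - w)" for z w
    using j(1) by (auto simp flip: complex_cnj_diff)
  then have "dist (T x) (T y) = c * dist x y" for x y
    using dk'[of "T x" "T y"] dk[of x y] by (simp add: kT d)
  moreover have "T O1 = O1'" "T O2 = O2'" using j(1) by (auto simp: T_def k01)
  moreover have "T P = P'" "T Q = Q'" by (rule inj; simp add: kT j)+
  ultimately show ?thesis by blast
qed

section \<open>Sides of edges on a closed surface\<close>

definition locally_planar :: "'a topology \<Rightarrow> bool" where
  "locally_planar S \<longleftrightarrow> (\<forall>x\<in>topspace S. \<exists>U. openin S U \<and> x \<in> U \<and>
     subtopology S U homeomorphic_space (euclidean :: complex topology))"

lemma locally_planar_chart:
  assumes "locally_planar S" and "x \<in> topspace S"
  obtains U \<phi> \<psi> where "openin S U" "x \<in> U"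
    "homeomorphic_maps (subtopology S U) (euclidean :: complex topology) \<phi> \<psi>"
  using assms unfolding locally_planar_def homeomorphic_space_def by blast

lemma planar_chartD:
  assumes U: "openin S U" and hom: "homeomorphic_maps (subtopology S U) (euclidean :: complex topology) \<phi> \<psi>"
  shows "continuous_map (subtopology S U) euclidean \<phi>"
    and "continuous_map euclidean S \<psi>"
    and "\<And>x. x \<in> U \<Longrightarrow> \<psi> (\<phi> x) = x" and "\<And>z. \<phi> (\<psi> z) = z" and "\<And>z. \<psi> z \<in> U"
    and "\<And>A. open A \<Longrightarrow> openin S (\<psi> ` A)"
    and "\<And>W. openin S W \<Longrightarrow> open (\<phi> ` (U \<inter> W))"
proof -
  have top: "topspace (subtopology S U) = U" using openin_subset[OF U] by auto
  show "continuous_map (subtopology S U) euclidean \<phi>" "continuous_map euclidean S \<psi>"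
    "\<And>x. x \<in> U \<Longrightarrow> \<psi> (\<phi> x) = x" "\<And>z. \<phi> (\<psi> z) = z" "\<And>z. \<psi> z \<in> U"
    using hom top unfolding homeomorphic_maps_def by (auto simp: continuous_map_in_subtopology)
  have "homeomorphic_map euclidean (subtopology S U) \<psi>" "homeomorphic_map (subtopology S U) euclidean \<phi>"
    using hom homeomorphic_maps_sym homeomorphic_maps_map by blast+
  then have o: "open_map euclidean (subtopology S U) \<psi>" "open_map (subtopology S U) euclidean \<phi>"
    by (auto intro: homeomorphic_imp_open_map)
  show "openin S (\<psi> ` A)" if "open A" for A
    using o(1) that U openin_trans_full by (auto simp: open_map_def)
  show "open (\<phi> ` (U \<inter> W))" if "openin S W" for W
    using o(2) that by (auto simp: open_map_def openin_subtopology_Int2)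
qed

text \<open>Invariance of domain for maps from the plane to the surface, applied in a chart around
  each point of the image.\<close>

lemma open_image_locally_planar:
  fixes G :: "complex \<Rightarrow> 'a"
  assumes S: "locally_planar S" and A: "open A" and cont: "continuous_map (top_of_set A) S G" and inj: "inj_on G A"
  shows "openin S (G ` A)"
proof (subst openin_subopen, intro ballI)
  fix x assume "x \<in> G ` A"
  moreover have "G ` A \<subseteq> topspace S" using continuous_map_image_subset_topspace[OF cont] by simp
  ultimately have "x \<in> topspace S" by blast
  with S obtain U \<phi> \<psi> where U: "openin S U" "x \<in> U" and
    hom: "homeomorphic_maps (subtopology S U) (euclidean :: complex topology) \<phi> \<psi>"
    by (rule locally_planar_chart)
  note chart = planar_chartD[OF U(1) hom]
  define B where "B = {z\<in>A. G z \<in> U}"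
  have "openin (top_of_set A) B"
    using openin_continuous_map_preimage[OF cont U(1)] by (simp add: B_def)
  then have B: "open B" using A by (simp add: openin_open_eq)
  have "continuous_map (top_of_set B) S G"
    using continuous_map_from_subtopology[OF cont, of B]
    by (simp add: B_def subtopology_subtopology Int_absorb1 Collect_restrict)
  then have "continuous_map (top_of_set B) (subtopology S U) G"
    by (rule continuous_map_into_subtopology) (auto simp: B_def)
  from continuous_map_compose[OF this chart(1)] have "continuous_on B (\<phi> \<circ> G)" by simp
  moreover have "inj_on (\<phi> \<circ> G) B"
  proof (rule comp_inj_on)
    show "inj_on G B" using inj by (rule inj_on_subset) (auto simp: B_def)
    show "inj_on \<phi> (G ` B)" using chart(3) by (intro inj_on_inverseI[of _ \<psi>]) (auto simp: B_def)
  qed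
  ultimately have "open ((\<phi> \<circ> G) ` B)" using B invariance_of_domain by blast
  then have "openin S (\<psi> ` (\<phi> \<circ> G) ` B)" by (rule chart(6))
  also have "\<psi> ` (\<phi> \<circ> G) ` B = G ` B" using chart(3) by (auto simp: B_def image_image)
  finally have "openin S (G ` B)" .
  moreover have "x \<in> G ` B" using \<open>x \<in> G ` A\<close> U by (auto simp: B_def)
  ultimately show "\<exists>T. openin S T \<and> x \<in> T \<and> T \<subseteq> G ` A"
    by (intro exI[of _ "G ` B"]) (auto simp: B_def)
qed

text \<open>The opposite direction, from the surface to the plane: composing with inverse charts
  reduces it to invariance of domain in the plane.\<close>

lemma open_image_of_locally_planar:
  fixes j :: "'a \<Rightarrow> complex"
  assumes S: "locally_planar S" and W: "openin S W"
    and cont: "continuous_map (subtopology S W) euclidean j" and inj: "inj_on j W"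
  shows "open (j ` W)"
proof (subst open_subopen, intro ballI)
  fix y assume "y \<in> j ` W"
  then obtain x where x: "x \<in> W" "y = j x" by blast
  with openin_subset[OF W] have "x \<in> topspace S" by blast
  with S obtain U \<phi> \<psi> where U: "openin S U" "x \<in> U" and
    hom: "homeomorphic_maps (subtopology S U) (euclidean :: complex topology) \<phi> \<psi>"
    by (rule locally_planar_chart)
  note chart = planar_chartD[OF U(1) hom]
  define B where "B = \<phi> ` (U \<inter> W)"
  have B: "open B" unfolding B_def by (rule chart(7)[OF W])
  have img: "\<psi> ` B = U \<inter> W" using chart(3) by (force simp: B_def image_image)
  have "continuous_map (top_of_set B) S \<psi>" using chart(2) by (rule continuous_map_from_subtopology)
  then have "continuous_map (top_of_set B) (subtopology S W) \<psi>"
    by (rule continuous_map_into_subtopology) (use img in auto)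
  from continuous_map_compose[OF this cont] have "continuous_on B (j \<circ> \<psi>)" by simp
  moreover have "inj_on (j \<circ> \<psi>) B"
  proof (rule comp_inj_on)
    show "inj_on \<psi> B" using chart(4) by (intro inj_on_inverseI[of _ \<phi>]) auto
    show "inj_on j (\<psi> ` B)" using inj img by (auto intro: inj_on_subset)
  qed
  ultimately have "open ((j \<circ> \<psi>) ` B)" using B invariance_of_domain by blast
  moreover have "(j \<circ> \<psi>) ` B = j ` (U \<inter> W)" unfolding image_comp[symmetric] img ..
  ultimately show "\<exists>T. open T \<and> y \<in> T \<and> T \<subseteq> j ` W"
    using x U by (intro exI[of _ "j ` (U \<inter> W)"]) auto
qed

section \<open>Arcs and sectors of the unit disc\<close>

lemma cis_eq_imp_eq:
  assumes "cis t = cis t'" and "\<bar>t - t'\<bar> < 2 * pi"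
  shows "t = t'"
proof -
  have "exp (\<i> * complex_of_real t) = exp (\<i> * complex_of_real t')"
    using assms(1) unfolding cis_conv_exp .
  moreover have "\<bar>Im (\<i> * complex_of_real t) - Im (\<i> * complex_of_real t')\<bar> < 2 * pi"
    using assms(2) by simp
  ultimately have "\<i> * complex_of_real t = \<i> * complex_of_real t'"
    by (rule exp_complex_eqI[rotated])
  then show ?thesis by simp
qed

lemma side_arc_bounds:
  assumes "k < n"
  shows "0 \<le> 2 * pi * real k / real n" "2 * pi * real (k + 1) / real n \<le> 2 * pi"
    "2 * pi * real k / real n < 2 * pi * real (k + 1) / real n"
proof -
  have "real (k + 1) \<le> real n" using assms by linarith
  then have "2 * pi * real (k + 1) \<le> 2 * pi * real n" by (intro mult_left_mono) auto
  moreover have "0 < real n" using assms by simp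
  ultimately show "2 * pi * real (k + 1) / real n \<le> 2 * pi" by (simp only: pos_divide_le_eq)
  show "2 * pi * real k / real n < 2 * pi * real (k + 1) / real n"
    using assms by (intro divide_strict_right_mono mult_strict_left_mono) auto
qed auto

lemma norm_side_arc: "y \<in> side_arc n k \<Longrightarrow> norm y = 1"
  by (auto simp: side_arc_def)

lemma side_arc_nonempty: "k < n \<Longrightarrow> side_arc n k \<noteq> {}"
  using dense[OF side_arc_bounds(3)] by (auto simp: side_arc_def)

lemma side_arc_disjoint:
  assumes "k < n" "k' < n" and "y \<in> side_arc n k" "y \<in> side_arc n k'"
  shows "k = k'"
proof -
  have False if "k < k'" "k < n" "k' < n" "y \<in> side_arc n k" "y \<in> side_arc n k'" for k k'
  proof -
    obtain t where t: "y = cis t" "2 * pi * real k / real n < t" "t < 2 * pi * real (k + 1) / real n"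
      using \<open>y \<in> side_arc n k\<close> unfolding side_arc_def by blast
    obtain t' where t': "y = cis t'" "2 * pi * real k' / real n < t'" "t' < 2 * pi * real (k' + 1) / real n"
      using \<open>y \<in> side_arc n k'\<close> unfolding side_arc_def by blast
    have "real (k + 1) \<le> real k'" using that(1) by linarith
    then have "2 * pi * real (k + 1) / real n \<le> 2 * pi * real k' / real n"
      by (intro divide_right_mono mult_left_mono) auto
    with t t' have "t < t'" by linarith
    moreover have "\<bar>t - t'\<bar> < 2 * pi"
      using t t' side_arc_bounds[OF that(2)] side_arc_bounds[OF that(3)] by linarith
    then have "t = t'" using t(1) t'(1) by (intro cis_eq_imp_eq) auto
    ultimately show False by linarith
  qed
  from this[of k k'] this[of k' k] assms show ?thesis by (cases k k' rule: linorder_cases) auto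
qed

text \<open>The open circular sector over a side, without its apex. Distinct sides of one face have
  disjoint sectors, so an edge with the same face on both sides needs no separate treatment.\<close>

definition sector :: "'a cell_complex \<Rightarrow> 'a set \<times> nat \<Rightarrow> complex set" where
  "sector C s = {u. 0 < norm u \<and> norm u < 1 \<and> sgn u \<in> side_arc (degree C (fst s)) (snd s)}"

section \<open>Closures and open unions of cells\<close>

locale surface_decomposition =
  fixes S :: "'a topology" and C :: "'a cell_complex"
  assumes surface: "closed_surface S" and cells: "cell_decomposition S C"
begin

lemma planar: "locally_planar S" and hausdorff: "Hausdorff_space S"
  using surface by (auto simp: closed_surface_def locally_planar_def)

lemma finite_cells [simp]: "finite (verts C)" "finite (edges C)" "finite (faces C)"
  and union_cells: "topspace S = verts C \<union> \<Union> (edges C) \<union> \<Union> (faces C)"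
  and disjoint_cells: "verts C \<inter> \<Union> (edges C) = {}" "verts C \<inter> \<Union> (faces C) = {}"
     "\<Union> (edges C) \<inter> \<Union> (faces C) = {}"
  and disjoint_edges: "pairwise disjnt (edges C)" and disjoint_faces: "pairwise disjnt (faces C)"
  and edge: "e \<in> edges C \<Longrightarrow> edge_cell S (verts C) e"
  and face: "f \<in> faces C \<Longrightarrow> face_cell S (verts C) (edges C) (degree C f) (char_map C f) f"
  using cells by (simp_all add: cell_decomposition_def)

lemma edge_subset: "e \<in> edges C \<Longrightarrow> e \<subseteq> topspace S"
  and face_subset: "f \<in> faces C \<Longrightarrow> f \<subseteq> topspace S"
  using union_cells by auto

lemma edge_eq: "e \<in> edges C \<Longrightarrow> e' \<in> edges C \<Longrightarrow> x \<in> e \<Longrightarrow> x \<in> e' \<Longrightarrow> e = e'"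
  using disjoint_edges by (auto simp: pairwise_def disjnt_def)

lemma face_eq: "f \<in> faces C \<Longrightarrow> f' \<in> faces C \<Longrightarrow> x \<in> f \<Longrightarrow> x \<in> f' \<Longrightarrow> f = f'"
  using disjoint_faces by (auto simp: pairwise_def disjnt_def)

lemma finite_sides: "finite (sides C)"
proof -
  have "sides C = (SIGMA f:faces C. {..<degree C f})" by (auto simp: sides_def)
  then show ?thesis by simp
qed

lemma char_map_continuous: "f \<in> faces C \<Longrightarrow> continuous_map (top_of_set (cball 0 1)) S (char_map C f)"
  and char_map_homeo: "f \<in> faces C \<Longrightarrow> homeomorphic_map (top_of_set (ball 0 1)) (subtopology S f) (char_map C f)"
  and char_map_vertex: "f \<in> faces C \<Longrightarrow>
    char_map C f ` (sphere 0 1 - (\<Union>k<degree C f. side_arc (degree C f) k)) \<subseteq> verts C"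
  using face by (auto simp: face_cell_def)

lemma char_map_ball: "f \<in> faces C \<Longrightarrow> char_map C f ` ball 0 1 = f"
  and char_map_inj: "f \<in> faces C \<Longrightarrow> inj_on (char_map C f) (ball 0 1)"
  using char_map_homeo[of f] face_subset[of f]
  by (auto simp: homeomorphic_eq_everything_map Int_absorb1)

lemma face_nonempty: "f \<in> faces C \<Longrightarrow> f \<noteq> {}"
  using char_map_ball[of f] by force

lemma side_homeo:
  assumes "s \<in> sides C"
  shows "side_edge C s \<in> edges C"
    and "homeomorphic_map (top_of_set (side_arc (degree C (fst s)) (snd s)))
          (subtopology S (side_edge C s)) (char_map C (fst s))"
proof -
  obtain e where e: "e \<in> edges C"
    "homeomorphic_map (top_of_set (side_arc (degree C (fst s)) (snd s))) (subtopology S e) (char_map C (fst s))"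
    using assms face[of "fst s"] unfolding sides_def face_cell_def by fastforce
  then have "side_edge C s = e"
    using edge_subset[of e] by (auto simp: homeomorphic_eq_everything_map side_edge_def)
  with e show "side_edge C s \<in> edges C"
    "homeomorphic_map (top_of_set (side_arc (degree C (fst s)) (snd s)))
          (subtopology S (side_edge C s)) (char_map C (fst s))" by auto
qed

lemma side_inj: "s \<in> sides C \<Longrightarrow> inj_on (char_map C (fst s)) (side_arc (degree C (fst s)) (snd s))"
  using side_homeo(2)[of s] by (auto simp: homeomorphic_eq_everything_map)

text \<open>The image of the closed unit interval is compact, hence closed in a Hausdorff
  space.\<close>

lemma edge_closure:
  assumes "e \<in> edges C"
  obtains B where "closedin S B" "e \<subseteq> B" "B \<subseteq> e \<union> verts C"
proof -
  obtain g where g: "continuous_map (top_of_set {0..1::real}) S g" "g ` {0, 1} \<subseteq> verts C"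
    "homeomorphic_map (top_of_set {0<..<1}) (subtopology S e) g"
    using edge[OF assms] by (auto simp: edge_cell_def)
  have img: "g ` {0<..<1} = e"
    using g(3) edge_subset[OF assms] by (auto simp: homeomorphic_eq_everything_map)
  have "compactin (top_of_set {0..1::real}) {0..1}" by (simp add: compactin_subtopology)
  then have "closedin S (g ` {0..1})"
    using g(1) hausdorff image_compactin compactin_imp_closedin by blast
  moreover have "{0..1} = {0<..<1} \<union> {0, 1::real}" by auto
  then have "g ` {0..1} = e \<union> g ` {0, 1}" using img by (metis image_Un)
  ultimately show ?thesis using g(2) that by blast
qed

lemma face_closure:
  assumes "f \<in> faces C"
  shows "closedin S (char_map C f ` cball 0 1)"
    and "f \<subseteq> char_map C f ` cball 0 1"
    and "char_map C f ` cball 0 1 \<subseteq> f \<union> verts C \<union> (\<Union>k<degree C f. side_edge C (f, k))"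
proof -
  have "compactin (top_of_set (cball 0 1)) (cball 0 (1::real) :: complex set)" by (simp add: compactin_subtopology)
  then show "closedin S (char_map C f ` cball 0 1)"
    using char_map_continuous[OF assms] hausdorff image_compactin compactin_imp_closedin by blast
  show "f \<subseteq> char_map C f ` cball 0 1" using char_map_ball[OF assms] ball_subset_cball by blast
  show "char_map C f ` cball 0 1 \<subseteq> f \<union> verts C \<union> (\<Union>k<degree C f. side_edge C (f, k))"
  proof
    fix x assume "x \<in> char_map C f ` cball 0 1"
    then obtain u where u: "norm u \<le> 1" "x = char_map C f u" by auto
    consider "u \<in> ball 0 1" | "u \<in> sphere 0 1 - (\<Union>k<degree C f. side_arc (degree C f) k)"
      | k where "k < degree C f" "u \<in> side_arc (degree C f) k"
      using u(1) by fastforce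
    then show "x \<in> f \<union> verts C \<union> (\<Union>k<degree C f. side_edge C (f, k))"
      using u(2) char_map_ball[OF assms] char_map_vertex[OF assms]
      by cases (auto simp: side_edge_def)
  qed
qed

text \<open>The complement is a finite union of closed sets: the vertices and the closures of the
  remaining edges and faces. By \<open>star\<close> the closure of a face outside \<open>X\<close>
  meets no edge of \<open>K\<close>.\<close>

lemma open_cells:
  assumes "K \<subseteq> edges C" "X \<subseteq> faces C"
    and star: "\<And>s. s \<in> sides C \<Longrightarrow> side_edge C s \<in> K \<Longrightarrow> fst s \<in> X"
  shows "openin S (\<Union>K \<union> \<Union>X)"
proof -
  have "\<forall>e\<in>edges C. \<exists>B. closedin S B \<and> e \<subseteq> B \<and> B \<subseteq> e \<union> verts C"
    using edge_closure by metis
  then obtain B where B: "\<And>e. e \<in> edges C \<Longrightarrow> closedin S (B e) \<and> e \<subseteq> B e \<and> B e \<subseteq> e \<union> verts C"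
    by metis
  define Z where "Z = verts C \<union> (\<Union>e\<in>edges C - K. B e) \<union> (\<Union>f\<in>faces C - X. char_map C f ` cball 0 1)"
  have "closedin S (verts C)" using union_cells by (intro closedin_Hausdorff_finite hausdorff) auto
  then have closed: "closedin S Z"
    unfolding Z_def using B face_closure(1) by (intro closedin_Un closedin_Union) auto
  have "topspace S - Z = \<Union>K \<union> \<Union>X"
  proof (intro equalityI subsetI)
    fix x assume x: "x \<in> topspace S - Z"
    then have "x \<notin> verts C" by (auto simp: Z_def)
    with x union_cells consider e where "e \<in> edges C" "x \<in> e" | f where "f \<in> faces C" "x \<in> f" by auto
    then show "x \<in> \<Union>K \<union> \<Union>X"
    proof cases
      case 1
      then have "x \<in> B e" using B by blast
      with 1 x show ?thesis by (auto simp: Z_def)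
    next
      case 2
      then have "x \<in> char_map C f ` cball 0 1" using face_closure(2) by blast
      with 2 x show ?thesis by (auto simp: Z_def)
    qed
  next
    fix x assume x: "x \<in> \<Union>K \<union> \<Union>X"
    then have top: "x \<in> topspace S" using assms union_cells by auto
    have nv: "x \<notin> verts C" using x assms disjoint_cells by blast
    have nB: "x \<notin> B e" if e: "e \<in> edges C - K" for e
    proof
      assume "x \<in> B e"
      with B e nv have "x \<in> e" by blast
      with x e assms disjoint_cells(3) obtain e' where "e' \<in> K" "x \<in> e'" by blast
      with edge_eq[of e e' x] \<open>x \<in> e\<close> e assms show False by blast
    qed
    have nF: "x \<notin> char_map C f ` cball 0 1" if f: "f \<in> faces C - X" for f
    proof
      assume "x \<in> char_map C f ` cball 0 1"
      with face_closure(3)[of f] f nv consider "x \<in> f" | k where "k < degree C f" "x \<in> side_edge C (f, k)"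
        by blast
      then show False
      proof cases
        case 1
        with x f assms disjoint_cells(3) obtain f' where "f' \<in> X" "x \<in> f'" by blast
        with face_eq[of f f' x] 1 f assms show False by blast
      next
        case 2
        then have s: "(f, k) \<in> sides C" using f by (auto simp: sides_def)
        with 2 x assms disjoint_cells(3) side_homeo(1)[OF s] obtain e where e: "e \<in> K" "x \<in> e" by blast
        with edge_eq[of e "side_edge C (f, k)" x] 2 side_homeo(1)[OF s] assms have "side_edge C (f, k) \<in> K" by blast
        from star[OF s this] f show False by simp
      qed
    qed
    from top nv nB nF show "x \<in> topspace S - Z" by (auto simp: Z_def)
  qed
  with closed show ?thesis by (metis openin_diff openin_topspace)
qed

section \<open>Every edge has exactly two sides\<close>

text \<open>An edge without sides would be open in the surface. Mapped into the real line inside the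
  complex plane it would be an open set, but the line contains no disc.\<close>

lemma edge_has_side:
  assumes e: "e \<in> edges C"
  shows "\<exists>s\<in>sides C. side_edge C s = e"
proof (rule ccontr)
  assume none: "\<not> ?thesis"
  have "openin S (\<Union>{e} \<union> \<Union>{})" using e none by (intro open_cells) auto
  then have op: "openin S e" by simp
  obtain g where "homeomorphic_map (top_of_set {0<..<1::real}) (subtopology S e) g"
    using edge[OF e] by (auto simp: edge_cell_def)
  then obtain i where gi: "homeomorphic_maps (top_of_set {0<..<1::real}) (subtopology S e) g i"
    by (auto simp: homeomorphic_map_maps)
  have top: "topspace (subtopology S e) = e" using edge_subset[OF e] by auto
  have i: "continuous_map (subtopology S e) euclidean i"
    using gi by (auto simp: homeomorphic_maps_def continuous_map_in_subtopology)
  have inv: "g (i x) = x" if "x \<in> e" for x using gi top that by (auto simp: homeomorphic_maps_def)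
  have "continuous_map (subtopology S e) euclidean (complex_of_real \<circ> i)"
    by (rule continuous_map_compose[OF i]) (simp add: continuous_on_of_real)
  moreover have "inj_on (complex_of_real \<circ> i) e"
    using inv by (intro inj_on_inverseI[of _ "g \<circ> Re"]) auto
  ultimately have "open ((complex_of_real \<circ> i) ` e)"
    by (rule open_image_of_locally_planar[OF planar op])
  moreover have "g (1 / 2) \<in> topspace (subtopology S e)"
    using gi by (auto simp: homeomorphic_maps_def continuous_map_def Pi_iff)
  then have "e \<noteq> {}" using top by auto
  then obtain r where "complex_of_real r \<in> (complex_of_real \<circ> i) ` e" by auto
  ultimately obtain \<epsilon> where \<epsilon>: "\<epsilon> > 0" "ball (complex_of_real r) \<epsilon> \<subseteq> (complex_of_real \<circ> i) ` e"
    by (meson open_contains_ball)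
  have "Complex r (\<epsilon> / 2) \<in> ball (complex_of_real r) \<epsilon>"
    using \<epsilon>(1) by (simp add: dist_norm complex_of_real_def cmod_def)
  with \<epsilon>(2) show False using \<epsilon>(1) by (auto simp: complex_eq_iff)
qed

text \<open>If \<open>s\<close> were the only side, the edge and its face would form an open set
  homeomorphic to the open disc together with an arc of its boundary circle, which is not open in
  the plane.\<close>

lemma edge_has_two_sides:
  assumes s: "s \<in> sides C"
  shows "\<exists>s'\<in>sides C. s' \<noteq> s \<and> side_edge C s' = side_edge C s"
proof (rule ccontr)
  assume "\<not> ?thesis"
  then have only: "\<And>s'. s' \<in> sides C \<Longrightarrow> side_edge C s' = side_edge C s \<Longrightarrow> s' = s" by blast
  obtain f k where fk: "s = (f, k)" by (cases s)
  define e where "e = side_edge C s"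
  define A where "A = side_arc (degree C f) k"
  define h where "h = char_map C f"
  have f: "f \<in> faces C" and k: "k < degree C f" using s by (auto simp: fk sides_def)
  have e: "e \<in> edges C" unfolding e_def by (rule side_homeo(1)[OF s])
  have hA: "h ` A = e" by (simp add: e_def fk side_edge_def A_def h_def)
  have hB: "h ` ball 0 1 = f" unfolding h_def by (rule char_map_ball[OF f])
  have ef: "e \<inter> f = {}" using disjoint_cells(3) e f by blast
  have op: "openin S (e \<union> f)"
    using open_cells[of "{e}" "{f}"] e f only by (auto simp: e_def fk)
  have "compact_space (top_of_set (cball 0 1 :: complex set))"
    by (simp add: compact_space_subtopology)
  \<comment> \<open>A continuous map from a compact to a Hausdorff space is closed. Closedness
    passes to the restriction since the smaller domain is the full preimage of
    \<open>e \<union> f\<close>, and this is where uniqueness of the side enters.\<close>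
  then have cl: "closed_map (top_of_set (cball 0 1)) S h"
    unfolding h_def by (intro continuous_imp_closed_map char_map_continuous f hausdorff)
  have pre: "{x \<in> topspace (top_of_set (cball 0 1)). h x \<in> e \<union> f} = ball 0 1 \<union> A"
  proof (intro equalityI subsetI)
    fix u assume "u \<in> {x \<in> topspace (top_of_set (cball 0 1)). h x \<in> e \<union> f}"
    then have u: "norm u \<le> 1" "h u \<in> e \<union> f" by auto
    show "u \<in> ball 0 1 \<union> A"
    proof (cases "norm u = 1")
      case True
      have "h u \<notin> verts C" using u e f disjoint_cells by blast
      with char_map_vertex[OF f] True obtain k' where k': "k' < degree C f" "u \<in> side_arc (degree C f) k'"
        by (fastforce simp: h_def)
      then have s': "(f, k') \<in> sides C" using f by (simp add: sides_def)
      have "h u \<in> side_edge C (f, k')" using k' by (simp add: side_edge_def h_def)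
      moreover have "h u \<in> e" using u(2) \<open>h u \<in> side_edge C (f, k')\<close> side_homeo(1)[OF s'] f disjoint_cells(3) by blast
      ultimately have "side_edge C (f, k') = e" using edge_eq side_homeo(1)[OF s'] e by blast
      then have "(f, k') = s" using only[OF s'] by (simp add: e_def)
      with k' show ?thesis by (simp add: fk A_def)
    qed (use u in auto)
  next
    fix u assume "u \<in> ball 0 1 \<union> A"
    then show "u \<in> {x \<in> topspace (top_of_set (cball 0 1)). h x \<in> e \<union> f}"
      using hA hB norm_side_arc[of u "degree C f" k] by (auto simp: A_def)
  qed
  have "homeomorphic_map (subtopology (top_of_set (cball 0 1)) (ball 0 1 \<union> A)) (subtopology S (e \<union> f)) h"
  proof (rule bijective_closed_imp_homeomorphic_map)
    show "closed_map (subtopology (top_of_set (cball 0 1)) (ball 0 1 \<union> A)) (subtopology S (e \<union> f)) h"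
      by (rule closed_map_restriction[OF cl pre])
    show "continuous_map (subtopology (top_of_set (cball 0 1)) (ball 0 1 \<union> A)) (subtopology S (e \<union> f)) h"
      by (rule continuous_map_into_subtopology)
         (use char_map_continuous[OF f] hA hB in \<open>auto simp: h_def intro!: continuous_map_from_subtopology\<close>)
    have "cball 0 1 \<inter> (ball 0 1 \<union> A) = ball 0 1 \<union> A" using norm_side_arc by (fastforce simp: A_def)
    then have dom: "topspace (subtopology (top_of_set (cball 0 1)) (ball 0 1 \<union> A)) = ball 0 1 \<union> A" by simp
    show "h ` topspace (subtopology (top_of_set (cball 0 1)) (ball 0 1 \<union> A)) = topspace (subtopology S (e \<union> f))"
      unfolding dom using hA hB edge_subset[OF e] face_subset[OF f] by auto
    have "inj_on h (ball 0 1)" "inj_on h A"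
      using char_map_inj[OF f] side_inj[OF s] by (auto simp: h_def A_def fk)
    then show "inj_on h (topspace (subtopology (top_of_set (cball 0 1)) (ball 0 1 \<union> A)))"
      unfolding dom inj_on_Un using hA hB ef by blast
  qed
  then obtain j where j: "homeomorphic_maps (subtopology (top_of_set (cball 0 1)) (ball 0 1 \<union> A)) (subtopology S (e \<union> f)) h j"
    by (auto simp: homeomorphic_map_maps)
  have jc: "continuous_map (subtopology S (e \<union> f)) euclidean j"
    using j by (auto simp: homeomorphic_maps_def continuous_map_in_subtopology)
  have sub: "cball 0 1 \<inter> (ball 0 1 \<union> A) = ball 0 1 \<union> A" using norm_side_arc by (fastforce simp: A_def)
  have jh: "j (h u) = u" if "u \<in> ball 0 1 \<union> A" for u
    using j that sub by (auto simp: homeomorphic_maps_def)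
  have img: "e \<union> f = h ` (ball 0 1 \<union> A)" using hA hB by blast
  have "inj_on j (e \<union> f)" unfolding img using jh by (intro inj_onI) force
  then have "open (j ` (e \<union> f))" by (rule open_image_of_locally_planar[OF planar op jc])
  moreover have "j ` (e \<union> f) = ball 0 1 \<union> A" unfolding img using jh by force
  moreover obtain y where y: "y \<in> A" using side_arc_nonempty[OF k] by (auto simp: A_def)
  ultimately obtain \<epsilon> where \<epsilon>: "\<epsilon> > 0" "ball y \<epsilon> \<subseteq> ball 0 1 \<union> A"
    by (metis UnI2 open_contains_ball)
  have ny: "norm y = 1" using y norm_side_arc by (simp add: A_def)
  \<comment> \<open>Moving radially outwards from a point of the arc leaves the closed unit
    disc.\<close>
  have "y + (\<epsilon> / 2) *\<^sub>R y \<in> ball y \<epsilon>" using \<epsilon> ny by (simp add: dist_norm)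
  then have "norm (y + (\<epsilon> / 2) *\<^sub>R y) \<le> 1" using \<epsilon>(2) norm_side_arc by (fastforce simp: A_def)
  moreover have "y + (\<epsilon> / 2) *\<^sub>R y = (1 + \<epsilon> / 2) *\<^sub>R y" by (simp add: algebra_simps)
  ultimately show False using \<epsilon>(1) ny by simp
qed

text \<open>The image point determines the face, injectivity on the open disc determines the point,
  and its direction determines the side.\<close>

lemma sector_disjoint:
  assumes s: "s \<in> sides C" "s' \<in> sides C" and u: "u \<in> sector C s" "v \<in> sector C s'"
    and eq: "char_map C (fst s) u = char_map C (fst s') v"
  shows "s = s' \<and> u = v"
proof -
  have f: "fst s \<in> faces C" "fst s' \<in> faces C" and k: "snd s < degree C (fst s)" "snd s' < degree C (fst s')"
    using s by (auto simp: sides_def)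
  have b: "u \<in> ball 0 1" "v \<in> ball 0 1" using u by (auto simp: sector_def)
  then have "char_map C (fst s) u \<in> fst s" "char_map C (fst s') v \<in> fst s'"
    using char_map_ball f by blast+
  with eq f have "fst s = fst s'" by (intro face_eq) auto
  moreover from this have "u = v" using char_map_inj[OF f(1)] eq b by (auto dest: inj_onD)
  moreover have "snd s = snd s'"
    using side_arc_disjoint[of "snd s" "degree C (fst s)" "snd s'" "sgn u"] k u calculation
    by (auto simp: sector_def)
  ultimately show ?thesis by (simp add: prod_eq_iff)
qed

lemma sector_image:
  assumes "s \<in> sides C" and "u \<in> sector C s"
  shows "char_map C (fst s) u \<in> fst s"
proof -
  have "char_map C (fst s) ` ball 0 1 = fst s" using assms(1) by (intro char_map_ball) (auto simp: sides_def)
  moreover have "u \<in> ball 0 1" using assms(2) by (simp add: sector_def)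
  ultimately show ?thesis by blast
qed

lemma side_arc_image: "u \<in> side_arc (degree C (fst s)) (snd s) \<Longrightarrow> char_map C (fst s) u \<in> side_edge C s"
  by (auto simp: side_edge_def)

lemma side_edge_face_disjoint: "s \<in> sides C \<Longrightarrow> f \<in> faces C \<Longrightarrow> side_edge C s \<inter> f = {}"
  using side_homeo(1)[of s] disjoint_cells(3) by blast

text \<open>The exponential map unrolls the sector of the first side to the left half of a strip; the
  sector of the second side becomes the right half, turned over so that it fits along the edge.\<close>

lemma glued_sectors:
  assumes s1: "s1 \<in> sides C" and s2: "s2 \<in> sides C" and ne: "s1 \<noteq> s2"
    and eq: "side_edge C s2 = side_edge C s1"
  obtains A :: "complex set" and G :: "complex \<Rightarrow> 'a" where "open A" "continuous_map (top_of_set A) S G" "inj_on G A"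
    "side_edge C s1 \<subseteq> G ` A"
    "G ` A \<subseteq> side_edge C s1 \<union> char_map C (fst s1) ` sector C s1 \<union> char_map C (fst s2) ` sector C s2"
proof -
  define h1 where "h1 = char_map C (fst s1)"
  define h2 where "h2 = char_map C (fst s2)"
  define A1 where "A1 = side_arc (degree C (fst s1)) (snd s1)"
  define A2 where "A2 = side_arc (degree C (fst s2)) (snd s2)"
  define e where "e = side_edge C s1"
  define a where "a = 2 * pi * real (snd s1) / real (degree C (fst s1))"
  define b where "b = 2 * pi * real (snd s1 + 1) / real (degree C (fst s1))"
  have f: "fst s1 \<in> faces C" "fst s2 \<in> faces C" and k: "snd s1 < degree C (fst s1)"
    using s1 s2 by (auto simp: sides_def)
  have ab: "0 \<le> a" "b \<le> 2 * pi" using side_arc_bounds[OF k] by (simp_all add: a_def b_def)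
  have A1: "A1 = cis ` {a<..<b}" by (auto simp: A1_def side_arc_def a_def b_def)
  have homeo1: "homeomorphic_map (top_of_set A1) (subtopology S e) h1"
    unfolding A1_def e_def h1_def by (rule side_homeo(2)[OF s1])
  have homeo2: "homeomorphic_map (top_of_set A2) (subtopology S e) h2"
    unfolding A2_def e_def h2_def eq[symmetric] by (rule side_homeo(2)[OF s2])
  have img: "h1 ` A1 = e" "h2 ` A2 = e"
    using eq by (simp_all add: e_def side_edge_def h1_def A1_def h2_def A2_def)
  have inj1: "inj_on h1 A1" and inj2: "inj_on h2 A2"
    using side_inj s1 s2 by (auto simp: h1_def h2_def A1_def A2_def)
  obtain i2 where i2: "homeomorphic_maps (top_of_set A2) (subtopology S e) h2 i2"
    using homeo2 by (auto simp: homeomorphic_map_maps)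
  \<comment> \<open>\<open>w\<close> expresses the edge, parametrised by the angle on the first arc,
    in the coordinates of the second disc; it absorbs a possible reversal of orientation.\<close>
  define w where "w = i2 \<circ> h1 \<circ> cis"
  have "continuous_map (top_of_set {a<..<b}) (top_of_set A1) cis"
    using A1 by (auto simp: continuous_map_in_subtopology intro!: continuous_intros)
  moreover have "continuous_map (top_of_set A1) (subtopology S e) h1"
    using homeo1 by (simp add: homeomorphic_eq_everything_map)
  moreover have "continuous_map (subtopology S e) (top_of_set A2) i2"
    using i2 by (simp add: homeomorphic_maps_def)
  ultimately have w: "continuous_map (top_of_set {a<..<b}) (top_of_set A2) w"
    unfolding w_def comp_assoc by (intro continuous_map_compose)
  then have w_cont: "continuous_on {a<..<b} w" by (simp add: continuous_map_in_subtopology)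
  have wA: "w t \<in> A2" if "t \<in> {a<..<b}" for t
    using w that by (auto simp: continuous_map_in_subtopology)
  have "e \<subseteq> topspace S" using edge_subset side_homeo(1)[OF s1] by (simp add: e_def)
  then have inv2: "h2 (i2 x) = x" if "x \<in> e" for x
    using i2 that by (auto simp: homeomorphic_maps_def)
  have hw: "h2 (w t) = h1 (cis t)" if "t \<in> {a<..<b}" for t
    using inv2[of "h1 (cis t)"] that img(1) A1 by (auto simp: w_def)
  have w_norm: "norm (w t) = 1" if "t \<in> {a<..<b}" for t
    using wA[OF that] norm_side_arc by (simp add: A2_def)
  \<comment> \<open>In this strip the segment \<open>Re z = 0\<close> corresponds to the edge. Its
    height is at most \<open>2 * pi\<close>, which keeps \<open>exp\<close> injective.\<close>
  define A where "A = {z. a < Im z \<and> Im z < b}"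
  \<comment> \<open>The factor \<open>exp (- Re z)\<close> places points with
    \<open>Re z > 0\<close> inside the second disc.\<close>
  define p where "p = (\<lambda>z. exp (- Re z) *\<^sub>R w (Im z))"
  define G where "G = (\<lambda>z. if Re z \<le> 0 then h1 (exp z) else h2 (p z))"
  have "open A"
    unfolding A_def by (intro open_Collect_conj open_halfspace_Im_gt open_halfspace_Im_lt)
  have exp_eq: "exp z = exp (Re z) *\<^sub>R cis (Im z)" for z :: complex
    by (simp add: exp_eq_polar scaleR_conv_of_real)
  have arc1: "exp z \<in> A1" if "z \<in> A" "Re z = 0" for z
    using that A1 by (auto simp: A_def exp_eq)
  have sec1: "exp z \<in> sector C s1" if "z \<in> A" "Re z < 0" for z
  proof -
    have "sgn (exp z) = cis (Im z)" by (simp add: exp_eq sgn_scaleR sgn_div_norm)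
    moreover have "cis (Im z) \<in> A1" using that A1 by (auto simp: A_def)
    ultimately show ?thesis using that by (simp add: sector_def A1_def)
  qed
  have sec2: "p z \<in> sector C s2" if "z \<in> A" "0 < Re z" for z
  proof -
    have "Im z \<in> {a<..<b}" using that by (simp add: A_def)
    note t = w_norm[OF this] wA[OF this]
    have "sgn (p z) = w (Im z)" using t by (simp add: p_def sgn_scaleR sgn_div_norm)
    moreover have "w (Im z) \<noteq> 0" using t by auto
    ultimately show ?thesis using that t by (simp add: sector_def A2_def p_def)
  qed
  have G_left: "G z = h1 (exp z)" "G z \<in> fst s1" if "z \<in> A" "Re z < 0" for z
    using that sector_image[OF s1 sec1] by (auto simp: G_def h1_def)
  have G_mid: "G z = h1 (exp z)" "G z \<in> e" if "z \<in> A" "Re z = 0" for z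
    using that arc1 img by (auto simp: G_def)
  have G_right: "G z = h2 (p z)" "G z \<in> fst s2" if "z \<in> A" "0 < Re z" for z
    using that sector_image[OF s2 sec2] by (auto simp: G_def h2_def)
  have ef: "e \<inter> fst s1 = {}" "e \<inter> fst s2 = {}"
    using side_edge_face_disjoint[OF s1] f by (auto simp: e_def)
  have "continuous_map (top_of_set A) S G"
    unfolding G_def
  proof (rule continuous_map_cases_le)
    show "continuous_map (top_of_set A) euclideanreal Re" by (simp add: continuous_on_Re continuous_on_id)
    show "continuous_map (top_of_set A) euclideanreal (\<lambda>_. 0)" by simp
    have "continuous_map (top_of_set (A \<inter> {z. Re z \<le> 0})) (top_of_set (cball 0 1)) exp"
      by (auto simp: continuous_map_in_subtopology intro!: continuous_intros)
    from continuous_map_compose[OF this char_map_continuous[OF f(1)]]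
    show "continuous_map (subtopology (top_of_set A) {x \<in> topspace (top_of_set A). Re x \<le> 0}) S (\<lambda>z. h1 (exp z))"
      by (simp add: subtopology_subtopology comp_def h1_def Int_def conj_commute)
    have "continuous_on A (\<lambda>z. w (Im z))"
      by (rule continuous_on_compose2[OF w_cont, where f = Im]) (auto simp: A_def intro!: continuous_intros)
    then have "continuous_on A p" unfolding p_def by (intro continuous_intros)
    then have "continuous_on (A \<inter> {z. 0 \<le> Re z}) p" by (rule continuous_on_subset) auto
    moreover have "norm (p z) \<le> 1" if "z \<in> A" "0 \<le> Re z" for z
      using that w_norm[of "Im z"] by (simp add: p_def A_def)
    ultimately have "continuous_map (top_of_set (A \<inter> {z. 0 \<le> Re z})) (top_of_set (cball 0 1)) p"
      by (auto simp: continuous_map_in_subtopology)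
    from continuous_map_compose[OF this char_map_continuous[OF f(2)]]
    show "continuous_map (subtopology (top_of_set A) {x \<in> topspace (top_of_set A). 0 \<le> Re x}) S (\<lambda>z. h2 (p z))"
      by (simp add: subtopology_subtopology comp_def h2_def Int_def conj_commute)
    show "h1 (exp z) = h2 (p z)" if "z \<in> topspace (top_of_set A)" "Re z = 0" for z
      using that hw[of "Im z"] by (simp add: p_def exp_eq A_def)
  qed
  moreover have "inj_on G A"
  proof (rule inj_onI)
    fix z z' assume z: "z \<in> A" "z' \<in> A" and Gz: "G z = G z'"
    have Im_eq: "Im z = Im z'" if "cis (Im z) = cis (Im z')"
      using that z ab by (intro cis_eq_imp_eq) (auto simp: A_def)
    consider "Re z < 0" "Re z' < 0" | "Re z = 0" "Re z' = 0" | "Re z > 0" "Re z' > 0"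
      | "Re z < 0" "Re z' > 0" | "Re z > 0" "Re z' < 0" | "Re z = 0" "Re z' \<noteq> 0" | "Re z \<noteq> 0" "Re z' = 0"
      by linarith
    then show "z = z'"
    proof cases
      case 1
      then have "h1 (exp z) = h1 (exp z')" using G_left z Gz by simp
      then have "exp z = exp z'"
        using sector_disjoint[OF s1 s1 sec1 sec1] z 1 by (simp add: h1_def)
      moreover have "\<bar>Im z - Im z'\<bar> < 2 * pi" using z ab by (auto simp: A_def)
      ultimately show ?thesis by (rule exp_complex_eqI[rotated])
    next
      case 2
      then have "h1 (exp z) = h1 (exp z')" using G_mid z Gz by simp
      then have "exp z = exp z'" using arc1 z 2 inj1 by (auto dest: inj_onD)
      moreover have "\<bar>Im z - Im z'\<bar> < 2 * pi" using z ab by (auto simp: A_def)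
      ultimately show ?thesis by (rule exp_complex_eqI[rotated])
    next
      case 3
      then have "h2 (p z) = h2 (p z')" using G_right z Gz by simp
      then have pe: "p z = p z'"
        using sector_disjoint[OF s2 s2 sec2 sec2] z 3 by (simp add: h2_def)
      have t: "Im z \<in> {a<..<b}" "Im z' \<in> {a<..<b}" using z by (auto simp: A_def)
      from pe have "norm (p z) = norm (p z')" by simp
      then have re: "Re z = Re z'" using t w_norm by (simp add: p_def)
      with pe have "w (Im z) = w (Im z')" by (simp add: p_def)
      then have "h1 (cis (Im z)) = h1 (cis (Im z'))" using hw t by metis
      then have "cis (Im z) = cis (Im z')" using inj1 A1 t by (auto dest: inj_onD)
      with re Im_eq show ?thesis by (simp add: complex_eq_iff)
    next
      case 4
      then have "h1 (exp z) = h2 (p z')" using G_left G_right z Gz by simp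
      with sector_disjoint[OF s1 s2 sec1 sec2] z 4 ne show ?thesis by (auto simp: h1_def h2_def)
    next
      case 5
      then have "h1 (exp z') = h2 (p z)" using G_left G_right z Gz by simp
      with sector_disjoint[OF s1 s2 sec1 sec2] z 5 ne show ?thesis by (auto simp: h1_def h2_def)
    next
      case 6
      then have "G z \<in> e" "G z' \<in> fst s1 \<union> fst s2"
        using G_mid G_left[of z'] G_right[of z'] z by (auto simp: neq_iff)
      with Gz ef show ?thesis by auto
    next
      case 7
      then have "G z' \<in> e" "G z \<in> fst s1 \<union> fst s2"
        using G_mid G_left[of z] G_right[of z] z by (auto simp: neq_iff)
      with Gz ef show ?thesis by auto
    qed
  qed
  moreover have "side_edge C s1 \<subseteq> G ` A"
  proof
    fix x assume "x \<in> side_edge C s1"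
    then have "x \<in> h1 ` cis ` {a<..<b}" using img(1) A1 by (simp add: e_def)
    then obtain t where t: "t \<in> {a<..<b}" "x = h1 (cis t)" by blast
    then have "\<i> * complex_of_real t \<in> A" "x = G (\<i> * complex_of_real t)"
      by (auto simp: A_def G_def exp_eq)
    then show "x \<in> G ` A" by blast
  qed
  moreover have "G ` A \<subseteq> side_edge C s1 \<union> h1 ` sector C s1 \<union> h2 ` sector C s2"
  proof clarify
    fix z assume z: "z \<in> A" "G z \<notin> h2 ` sector C s2" "G z \<notin> h1 ` sector C s1"
    consider "Re z < 0" | "Re z = 0" | "Re z > 0" by linarith
    then show "G z \<in> side_edge C s1"
      by cases (use z G_left(1) G_mid(2) G_right(1) sec1 sec2 in \<open>auto simp: e_def\<close>)
  qed
  ultimately show ?thesis using \<open>open A\<close> that by (auto simp: h1_def h2_def)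
qed

text \<open>The glued strip of the first two sides has an open image containing the edge. Points of
  the third sector close to the edge would lie in it, although the image consists of the edge and
  two sectors disjoint from the third.\<close>

lemma edge_has_at_most_two_sides:
  assumes s: "s1 \<in> sides C" "s2 \<in> sides C" "s3 \<in> sides C" and ne: "s1 \<noteq> s2" "s1 \<noteq> s3" "s2 \<noteq> s3"
    and eq: "side_edge C s2 = side_edge C s1" "side_edge C s3 = side_edge C s1"
  shows False
proof -
  obtain A :: "complex set" and G :: "complex \<Rightarrow> 'a" where G: "open A" "continuous_map (top_of_set A) S G" "inj_on G A"
    "side_edge C s1 \<subseteq> G ` A"
    "G ` A \<subseteq> side_edge C s1 \<union> char_map C (fst s1) ` sector C s1 \<union> char_map C (fst s2) ` sector C s2"
    using glued_sectors[OF s(1,2) ne(1) eq(1)] by blast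
  have f3: "fst s3 \<in> faces C" and k3: "snd s3 < degree C (fst s3)" using s by (auto simp: sides_def)
  obtain y where y: "y \<in> side_arc (degree C (fst s3)) (snd s3)" using side_arc_nonempty[OF k3] by blast
  then have ny: "norm y = 1" by (rule norm_side_arc)
  define B where "B = {u \<in> cball 0 1. char_map C (fst s3) u \<in> G ` A}"
  have "openin (top_of_set (cball 0 1)) B"
    using openin_continuous_map_preimage[OF char_map_continuous[OF f3] open_image_locally_planar[OF planar G(1-3)]]
    by (simp add: B_def)
  moreover have "y \<in> B" using y ny G(4) side_arc_image[of y s3] eq by (auto simp: B_def)
  ultimately obtain \<epsilon> where \<epsilon>: "\<epsilon> > 0" "\<And>u. u \<in> cball 0 1 \<Longrightarrow> dist u y < \<epsilon> \<Longrightarrow> u \<in> B"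
    unfolding openin_euclidean_subtopology_iff by blast
  \<comment> \<open>The bound 1/2 keeps \<open>u\<close> away from the apex, so that its direction
    is \<open>y\<close>; the other bound puts it within \<epsilon> of \<open>y\<close>.\<close>
  define r where "r = max (1 / 2) (1 - \<epsilon> / 2)"
  have r: "0 < r" "r < 1" "1 - r < \<epsilon>" using \<epsilon>(1) by (auto simp: r_def)
  define u where "u = r *\<^sub>R y"
  have "u - y = (r - 1) *\<^sub>R y" by (simp add: u_def algebra_simps)
  then have "dist u y < \<epsilon>" "norm u = r" using r ny by (simp_all add: dist_norm u_def)
  then have "u \<in> B" using \<epsilon>(2) r by auto
  have "sgn u = y" using r ny by (simp add: u_def sgn_scaleR sgn_div_norm)
  moreover have "u \<noteq> 0" using r \<open>norm u = r\<close> by auto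
  ultimately have u: "u \<in> sector C s3" using y r \<open>norm u = r\<close> by (simp add: sector_def)
  have "char_map C (fst s3) u \<notin> side_edge C s1"
    using sector_image[OF s(3) u] side_edge_face_disjoint[OF s(1) f3] by blast
  moreover have "char_map C (fst s3) u \<in> G ` A" using \<open>u \<in> B\<close> by (simp add: B_def)
  ultimately consider v where "v \<in> sector C s1" "char_map C (fst s3) u = char_map C (fst s1) v"
    | v where "v \<in> sector C s2" "char_map C (fst s3) u = char_map C (fst s2) v"
    using G(5) by blast
  then show False
  proof cases
    case 1
    from sector_disjoint[OF s(3) s(1) u this] ne show False by simp
  next
    case 2
    from sector_disjoint[OF s(3) s(2) u this] ne show False by simp
  qed
qed

lemma ex1_opposite_side:
  assumes "s \<in> sides C"
  shows "\<exists>!s'. s' \<in> sides C \<and> s' \<noteq> s \<and> side_edge C s' = side_edge C s"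
proof -
  obtain s' where s': "s' \<in> sides C" "s' \<noteq> s" "side_edge C s' = side_edge C s"
    using edge_has_two_sides[OF assms] by blast
  show ?thesis
  proof (intro ex1I[of _ s'] conjI s')
    fix t assume t: "t \<in> sides C \<and> t \<noteq> s \<and> side_edge C t = side_edge C s"
    show "t = s'"
    proof (rule ccontr)
      assume "t \<noteq> s'"
      with t s' show False by (intro edge_has_at_most_two_sides[OF assms s'(1), of t]) auto
    qed
  qed
qed

lemma opposite_side:
  assumes "s \<in> sides C"
  shows "opposite_side C s \<in> sides C" "opposite_side C s \<noteq> s"
    "side_edge C (opposite_side C s) = side_edge C s"
  using theI'[OF ex1_opposite_side[OF assms]] by (simp_all add: opposite_side_def)

lemma opposite_side_eq:
  assumes "s \<in> sides C" "s' \<in> sides C" "s' \<noteq> s" "side_edge C s' = side_edge C s"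
  shows "opposite_side C s = s'"
  unfolding opposite_side_def using assms by (intro the1_equality ex1_opposite_side) auto

lemma opposite_opposite_side: "s \<in> sides C \<Longrightarrow> opposite_side C (opposite_side C s) = s"
  by (rule opposite_side_eq) (simp_all add: opposite_side opposite_side(2)[symmetric])

lemma sides_of_edge: "s \<in> sides C \<Longrightarrow> {s'\<in>sides C. side_edge C s' = side_edge C s} = {s, opposite_side C s}"
  using opposite_side[of s] opposite_side_eq[of s] by blast

section \<open>Adjacency of faces across edges\<close>

text \<open>The plane minus a finite set is connected, and a nonempty open subset of it is never
  finite. The last property says that the non-vertices are dense in \<open>U\<close>.\<close>

lemma chart_connected_off_vertices:
  assumes "x \<in> topspace S"
  obtains U where "openin S U" "x \<in> U" "connectedin S (U - verts C)"
    "\<forall>W. openin S W \<longrightarrow> W \<inter> U \<noteq> {} \<longrightarrow> W \<inter> (U - verts C) \<noteq> {}"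
proof -
  obtain U \<phi> \<psi> where U: "openin S U" "x \<in> U" and
    hom: "homeomorphic_maps (subtopology S U) (euclidean :: complex topology) \<phi> \<psi>"
    using planar assms by (rule locally_planar_chart)
  note chart = planar_chartD[OF U(1) hom]
  have inj: "inj \<psi>" by (rule inj_on_inverseI[of _ \<phi>]) (rule chart(4))
  have fin: "finite (\<psi> -` verts C)" by (rule finite_vimageI[OF _ inj]) simp
  then have "connected (UNIV - \<psi> -` verts C)"
    by (rule connected_open_delete_finite[OF open_UNIV connected_UNIV, rotated]) simp
  then have "connectedin S (\<psi> ` (UNIV - \<psi> -` verts C))"
    by (intro connectedin_continuous_map_image[OF chart(2)]) simp
  moreover have "\<psi> ` (UNIV - \<psi> -` verts C) = U - verts C"
  proof (intro equalityI subsetI)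
    fix y assume "y \<in> U - verts C"
    then have "y = \<psi> (\<phi> y)" "\<phi> y \<in> UNIV - \<psi> -` verts C" by (simp_all add: chart(3))
    then show "y \<in> \<psi> ` (UNIV - \<psi> -` verts C)" by blast
  qed (use chart(5) in auto)
  moreover have "W \<inter> (U - verts C) \<noteq> {}" if W: "openin S W" "W \<inter> U \<noteq> {}" for W
  proof
    assume empty: "W \<inter> (U - verts C) = {}"
    have "\<phi> ` (U \<inter> W) \<subseteq> \<psi> -` verts C"
    proof clarify
      fix y assume "y \<in> U" "y \<in> W"
      moreover from this have "y \<in> verts C" using empty by blast
      ultimately show "\<phi> y \<in> \<psi> -` verts C" by (simp add: chart(3))
    qed
    then have "finite (\<phi> ` (U \<inter> W))" using fin by (rule finite_subset)
    with finite_imp_not_open[OF this] chart(7)[OF W(1)] W(2) show False by auto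
  qed
  ultimately show ?thesis by (intro that[OF U]) simp_all
qed

text \<open>Otherwise the faces of \<open>X\<close> with their edges and the remaining faces with
  theirs would be disjoint open sets covering the surface minus the vertices. Charts extend this
  separation over the vertices, against connectedness.\<close>

lemma faces_adjacent:
  assumes X: "X \<subseteq> faces C" "X \<noteq> {}" "X \<noteq> faces C"
  shows "\<exists>s\<in>sides C. fst s \<in> X \<and> fst (opposite_side C s) \<notin> X"
proof (rule ccontr)
  assume none: "\<not> ?thesis"
  define P where "P = (\<lambda>Y. \<Union>(side_edge C ` {s\<in>sides C. fst s \<in> Y}) \<union> \<Union>Y)"
  \<comment> \<open>Two sides of one edge are opposite to each other, so the assumption forbids a
    passage from \<open>X\<close> to the complement and, read from the other side, back.\<close>
  have closed: "fst s' \<in> Y"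
    if "Y = X \<or> Y = faces C - X" "s \<in> sides C" "s' \<in> sides C" "fst s \<in> Y" "side_edge C s' = side_edge C s" for Y s s'
  proof (cases "s' = s")
    case False
    then have opp: "opposite_side C s = s'" "opposite_side C s' = s"
      using that by (simp_all add: opposite_side_eq)
    have F: "fst s' \<in> faces C" using that(3) by (auto simp: sides_def)
    from that(1) show ?thesis
    proof
      assume "Y = X"
      with none that(2,4) opp show ?thesis by auto
    next
      assume Y: "Y = faces C - X"
      with that(4) have "fst (opposite_side C s') \<notin> X" by (simp add: opp)
      with none that(3) have "fst s' \<notin> X" by blast
      with F Y show ?thesis by simp
    qed
  qed (use that in auto)
  have opn: "openin S (P Y)" if Y: "Y = X \<or> Y = faces C - X" for Y
    unfolding P_def
  proof (rule open_cells)
    show "fst s \<in> Y" if "s \<in> sides C" "side_edge C s \<in> side_edge C ` {s\<in>sides C. fst s \<in> Y}" for s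
      using that(2) closed[OF Y _ that(1)] by (elim imageE) auto
  qed (use X Y side_homeo(1) in auto)
  define A where "A = P X"
  define B where "B = P (faces C - X)"
  have op: "openin S A" "openin S B" using opn by (auto simp: A_def B_def)
  have P_cases: "(\<exists>s\<in>sides C. fst s \<in> Y \<and> x \<in> side_edge C s) \<or> (\<exists>f\<in>Y. x \<in> f)" if "x \<in> P Y" for x Y
    using that unfolding P_def by blast
  have disj: "A \<inter> B = {}"
  proof (rule ccontr)
    assume "A \<inter> B \<noteq> {}"
    then obtain x where x: "x \<in> P X" "x \<in> P (faces C - X)" unfolding A_def B_def by blast
    from P_cases[OF x(1)] P_cases[OF x(2)] consider
        s s' where "s \<in> sides C" "s' \<in> sides C" "x \<in> side_edge C s" "x \<in> side_edge C s'"
          "fst s \<in> X" "fst s' \<in> faces C - X"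
      | s f where "s \<in> sides C" "x \<in> side_edge C s" "f \<in> faces C" "x \<in> f"
      | f f' where "x \<in> f" "x \<in> f'" "f \<in> X" "f' \<in> faces C - X"
      using X(1) by blast
    then show False
    proof cases
      case 1
      then have "side_edge C s' = side_edge C s" by (intro edge_eq side_homeo(1))
      with closed[of X s s'] 1 show False by simp
    next
      case 2
      with side_edge_face_disjoint[of s f] show False by blast
    next
      case 3
      then have "f = f'" using X(1) by (intro face_eq[of f f' x]) auto
      with 3 show False by simp
    qed
  qed
  have cover: "topspace S - verts C \<subseteq> A \<union> B"
  proof
    fix x assume "x \<in> topspace S - verts C"
    then consider e where "e \<in> edges C" "x \<in> e" | f where "f \<in> faces C" "x \<in> f"
      using union_cells by auto
    then show "x \<in> A \<union> B"
    proof cases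
      case 1
      then obtain s where s: "s \<in> sides C" "side_edge C s = e" using edge_has_side by blast
      then have "fst s \<in> X \<or> fst s \<in> faces C - X" by (auto simp: sides_def)
      with 1 s show ?thesis unfolding A_def B_def P_def by blast
    qed (auto simp: A_def B_def P_def)
  qed
  have nov: "A \<inter> verts C = {}" "B \<inter> verts C = {}"
    using P_cases[of _ X] P_cases[of _ "faces C - X"] disjoint_cells(1,2) X(1) side_homeo(1)
    unfolding A_def B_def by blast+
  \<comment> \<open>These are the open sets in which the vertices are negligible; \<open>A'\<close>
    and \<open>B'\<close> arise from \<open>A\<close> and \<open>B\<close> by adding vertices whose
    punctured neighbourhoods lie in the respective set.\<close>
  define \<U> where "\<U> = {U. openin S U \<and> (\<forall>W. openin S W \<longrightarrow> W \<inter> U \<noteq> {} \<longrightarrow> W \<inter> (U - verts C) \<noteq> {})}"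
  define A' where "A' = \<Union>{U\<in>\<U>. U - verts C \<subseteq> A}"
  define B' where "B' = \<Union>{U\<in>\<U>. U - verts C \<subseteq> B}"
  have op': "openin S A'" "openin S B'" by (auto simp: A'_def B'_def \<U>_def)
  have AB': "x \<in> A' \<or> x \<in> B'" if x: "x \<in> topspace S" for x
  proof -
    obtain U where U: "openin S U" "x \<in> U" "connectedin S (U - verts C)"
      "\<forall>W. openin S W \<longrightarrow> W \<inter> U \<noteq> {} \<longrightarrow> W \<inter> (U - verts C) \<noteq> {}"
      using chart_connected_off_vertices[OF x] .
    then have "U \<in> \<U>" by (simp add: \<U>_def)
    \<comment> \<open>Being connected, the punctured chart cannot meet both of the disjoint open
      sets \<open>A\<close> and \<open>B\<close>.\<close>
    have "U - verts C \<subseteq> A \<union> B" using cover openin_subset[OF U(1)] by blast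
    then have "A \<inter> (U - verts C) = {} \<or> B \<inter> (U - verts C) = {}"
      using U(3) op disj unfolding connectedin by blast
    then have "U - verts C \<subseteq> A \<or> U - verts C \<subseteq> B" using \<open>U - verts C \<subseteq> A \<union> B\<close> by blast
    then show ?thesis using U(2) \<open>U \<in> \<U>\<close> by (auto simp: A'_def B'_def)
  qed
  have "A' \<inter> B' = {}"
  proof (rule ccontr)
    assume "A' \<inter> B' \<noteq> {}"
    then obtain U U' where U: "U \<in> \<U>" "U - verts C \<subseteq> A" "U' \<in> \<U>" "U' - verts C \<subseteq> B" "U \<inter> U' \<noteq> {}"
      by (auto simp: A'_def B'_def)
    \<comment> \<open>Overlapping members of the family meet even off the vertices, hence in
      \<open>A \<inter> B\<close>.\<close>
    then have "U \<inter> (U' - verts C) \<noteq> {}" by (auto simp: \<U>_def)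
    with U disj show False by blast
  qed
  moreover have "A' \<noteq> {}"
  proof -
    obtain f x where "f \<in> X" "x \<in> f" using X face_nonempty by blast
    then have x: "x \<in> A" "x \<in> topspace S" using X(1) union_cells by (auto simp: A_def P_def)
    have "x \<notin> B'"
      using x(1) disj nov by (auto simp: B'_def)
    with AB' x show ?thesis by blast
  qed
  moreover have "B' \<noteq> {}"
  proof -
    obtain f x where "f \<in> faces C - X" "x \<in> f" using X face_nonempty by blast
    then have x: "x \<in> B" "x \<in> topspace S" using union_cells by (auto simp: B_def P_def)
    have "x \<notin> A'"
      using x(1) disj nov by (auto simp: A'_def)
    with AB' x show ?thesis by blast
  qed
  moreover have "connected_space S" using surface by (simp add: closed_surface_def)
  ultimately show False using op' AB' unfolding connected_space_def by blast
qed

end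

section \<open>Circle patterns\<close>

locale weighted_surface = surface_decomposition S C
  for S :: "'a topology" and C :: "'a cell_complex" +
  fixes D :: "'a set \<Rightarrow> real"
  assumes D_bounds: "e \<in> edges C \<Longrightarrow> 0 < D e \<and> D e < pi"
begin

lemma side_D: "s \<in> sides C \<Longrightarrow> 0 < D (side_edge C s)" "s \<in> sides C \<Longrightarrow> D (side_edge C s) < pi"
  using D_bounds side_homeo(1) by blast+

text \<open>All topological input ends here: the pairing of sides and the connectedness of the dual
  graph carry over to the abstract setting.\<close>

sublocale glued_sides "faces C" "sides C" fst "opposite_side C" "\<lambda>s. D (side_edge C s)"
  using finite_sides opposite_side opposite_opposite_side side_D faces_adjacent
  by unfold_locales (auto simp: sides_def)

text \<open>Summation over the fibres of \<open>side_edge\<close>: the fibre of an edge within the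
  sides of \<open>X\<close> has two elements if both adjacent faces belong to \<open>X\<close>, and
  one otherwise. The weight \<open>g\<close> is chosen so that each fibre sums to
  \<open>D e\<close>.\<close>

lemma sum_edges_of:
  assumes X: "X \<subseteq> faces C"
  shows "(\<Sum>e\<in>edges_of C X. D e) =
    (\<Sum>s\<in>inner X. D (side_edge C s) / 2) + (\<Sum>s\<in>border X. D (side_edge C s))"
proof -
  define Z where "Z = {s\<in>sides C. fst s \<in> X}"
  define g where "g = (\<lambda>s. if fst (opposite_side C s) \<in> X then D (side_edge C s) / 2 else D (side_edge C s))"
  have Z: "finite Z" using finite_sides by (simp add: Z_def)
  have edges: "edges_of C X = side_edge C ` Z"
  proof (intro equalityI subsetI)
    fix e assume "e \<in> edges_of C X"
    then obtain f k where "f \<in> X" "k < degree C f" "side_edge C (f, k) = e"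
      by (auto simp: edges_of_def is_edge_of_def)
    then show "e \<in> side_edge C ` Z" using X by (intro image_eqI[of _ _ "(f, k)"]) (auto simp: Z_def sides_def)
  next
    fix e assume "e \<in> side_edge C ` Z"
    then obtain f k where "(f, k) \<in> sides C" "f \<in> X" "e = side_edge C (f, k)" by (auto simp: Z_def)
    then show "e \<in> edges_of C X"
      using side_homeo(1)[of "(f, k)"] by (auto simp: edges_of_def is_edge_of_def sides_def)
  qed
  have "(\<Sum>s\<in>inner X. D (side_edge C s) / 2) + (\<Sum>s\<in>border X. D (side_edge C s)) =
      sum g (inner X) + sum g (border X)"
    by (intro arg_cong2[of _ _ _ _ "(+)"] sum.cong refl) (auto simp: g_def inner_def border_def)
  also have "\<dots> = sum g (inner X \<union> border X)"
    by (intro sum.union_disjoint[symmetric]) (auto simp: inner_def border_def finite_sides)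
  also have "inner X \<union> border X = Z" by (auto simp: inner_def border_def Z_def)
  also have "sum g Z = (\<Sum>e\<in>edges_of C X. \<Sum>s | s \<in> Z \<and> side_edge C s = e. g s)"
    using Z by (intro sum.group[symmetric]) (auto simp: edges)
  also have "\<dots> = (\<Sum>e\<in>edges_of C X. D e)"
  proof (rule sum.cong[OF refl])
    fix e assume "e \<in> edges_of C X"
    then obtain s where s: "s \<in> sides C" "fst s \<in> X" "side_edge C s = e" by (auto simp: edges Z_def)
    note opp = opposite_side[OF s(1)] opposite_opposite_side[OF s(1)]
    have "{s' \<in> Z. side_edge C s' = e} = {s, opposite_side C s} \<inter> {s'. fst s' \<in> X}"
      using sides_of_edge[OF s(1)] s(3) by (auto simp: Z_def)
    also have "\<dots> = (if fst (opposite_side C s) \<in> X then {s, opposite_side C s} else {s})"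
      using s(2) by auto
    finally have "{s' \<in> Z. side_edge C s' = e} = \<dots>" .
    then show "(\<Sum>s | s \<in> Z \<and> side_edge C s = e. g s) = D e"
      using opp s by (simp add: g_def)
  qed
  finally show ?thesis ..
qed

lemma edges_of_faces: "edges_of C (faces C) = edges C"
proof
  show "edges C \<subseteq> edges_of C (faces C)"
  proof
    fix e assume e: "e \<in> edges C"
    then obtain f k where "(f, k) \<in> sides C" "side_edge C (f, k) = e" using edge_has_side by force
    with e show "e \<in> edges_of C (faces C)" by (auto simp: edges_of_def is_edge_of_def sides_def)
  qed
qed (auto simp: edges_of_def)

section \<open>Circle patterns and logarithmic radii\<close>

lemma circle_patternD:
  assumes "euclidean_circle_pattern C D p" and "s \<in> sides C"
  shows "0 < radius p (fst s)"
    and "corner1 p (side_edge C s) \<noteq> corner2 p (side_edge C s)"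
    and "dist (centre p s) (corner1 p (side_edge C s)) = radius p (fst s)"
    and "dist (centre p s) (corner2 p (side_edge C s)) = radius p (fst s)"
    and "dist (centre p (opposite_side C s)) (corner1 p (side_edge C s)) = radius p (fst (opposite_side C s))"
    and "dist (centre p (opposite_side C s)) (corner2 p (side_edge C s)) = radius p (fst (opposite_side C s))"
    and "angle_at (centre p s) (corner1 p (side_edge C s)) (centre p (opposite_side C s)) = pi - D (side_edge C s)"
  using assms by (auto simp: euclidean_circle_pattern_def Let_def sides_def)

lemma half_angle_eq:
  assumes p: "euclidean_circle_pattern C D p" and s: "s \<in> sides C"
  shows "half_angle C p s =
    kite_angle (D (side_edge C s)) (ln (radius p (fst (opposite_side C s))) - ln (radius p (fst s)))"
  unfolding half_angle_def
  using circle_patternD[OF p s] circle_patternD(1)[OF p opposite_side(1)[OF s]] side_D[OF s]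
  by (intro angle_at_centre) auto

lemma cone_angle_eq:
  assumes p: "euclidean_circle_pattern C D p" and f: "f \<in> faces C"
  shows "cone_angle C p f = 2 * half_cone (\<lambda>f. ln (radius p f)) f"
proof -
  have "(\<Sum>k<degree C f. half_angle C p (f, k)) = (\<Sum>s | s \<in> sides C \<and> fst s = f. half_angle C p s)"
    using f by (intro sum.reindex_bij_witness[of _ snd "\<lambda>k. (f, k)"]) (auto simp: sides_def)
  also have "\<dots> = half_cone (\<lambda>f. ln (radius p f)) f"
    unfolding half_cone_def by (intro sum.cong refl) (auto simp: half_angle_eq[OF p])
  finally show ?thesis by (simp add: cone_angle_def sum_distrib_left[symmetric])
qed

text \<open>Any radii are realised for the given \<open>D\<close>, because every kite lives in its
  own plane and can be placed in the model position independently; the radii determine only the cone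
  angles.\<close>

lemma circle_pattern_exists: "\<exists>p. euclidean_circle_pattern C D p \<and> (\<forall>f. radius p f = exp (\<rho> f))"
proof -
  \<comment> \<open>One of the two sides of each edge is selected to carry the first centre of the
    model kite, the one with abscissa \<open>- r s * cos (t s)\<close>; the opposite side carries
    the second.\<close>
  define rep where "rep = (\<lambda>e. SOME s. s \<in> sides C \<and> side_edge C s = e)"
  define t where "t = (\<lambda>s. kite_angle (D (side_edge C s)) (\<rho> (fst (opposite_side C s)) - \<rho> (fst s)))"
  define r where "r = (\<lambda>s :: 'a set \<times> nat. exp (\<rho> (fst s)))"
  define h where "h = (\<lambda>e. r (rep e) * sin (t (rep e)))"
  define p where "p = \<lparr>radius = (\<lambda>f. exp (\<rho> f)),
    centre = (\<lambda>s. if s = rep (side_edge C s) then Complex (- r s * cos (t s)) 0 else Complex (r s * cos (t s)) 0),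
    corner1 = (\<lambda>e. Complex 0 (h e)), corner2 = (\<lambda>e. Complex 0 (- h e))\<rparr>"
  have sel: "radius p f = exp (\<rho> f)" "corner1 p e = Complex 0 (h e)" "corner2 p e = Complex 0 (- h e)" for f e
    by (simp_all add: p_def)
  have "euclidean_circle_pattern C D p"
    unfolding euclidean_circle_pattern_def Let_def
  proof (intro conjI ballI)
    fix s assume s: "s \<in> sides C"
    define e where "e = side_edge C s"
    define R where "R = rep e"
    define R' where "R' = opposite_side C R"
    have R: "R \<in> sides C" "side_edge C R = e"
      using someI[of "\<lambda>s'. s' \<in> sides C \<and> side_edge C s' = e" s] s by (auto simp: R_def rep_def e_def)
    have R': "R' \<in> sides C" "R' \<noteq> R" "side_edge C R' = e" "opposite_side C R' = R"
      unfolding R'_def using opposite_side[OF R(1)] opposite_opposite_side[OF R(1)] R(2) by auto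
    have opp_R: "opposite_side C R = R'" by (simp add: R'_def)
    have cases: "s = R \<or> s = R'" using sides_of_edge[OF R(1)] s R(2) by (auto simp: R'_def e_def)
    have centre: "centre p R = Complex (- r R * cos (t R)) 0" "centre p R' = Complex (r R' * cos (t R')) 0"
      using R R' by (simp_all add: p_def R_def)
    have De: "0 < D e" "D e < pi" using side_D[OF R(1)] by (simp_all add: R)
    have pos: "0 < r R" "0 < r R'" by (simp_all add: r_def)
    have h: "r R * sin (t R) = h e" by (simp add: h_def R_def)
    have kite: "r R * sin (t R) = r R' * sin (t R')" "t R + t R' = D e" "0 < sin (t R)"
      using kite_law_of_sines[OF De pos] by (simp_all add: t_def r_def R R' flip: R'_def)
    then have h': "r R' * sin (t R') = h e" using h by simp
    \<comment> \<open>A nonzero half chord keeps the two corners distinct.\<close>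
    have "h e \<noteq> 0" using h kite(3) pos by auto
    then show "corner1 p (side_edge C s) \<noteq> corner2 p (side_edge C s)" by (simp add: sel e_def)
    note corner = angle_at_corner[OF De pos kite(2) h h', folded centre]
    note corners = corner[of "h e", OF disjI1[OF refl]] corner[of "- h e", OF disjI2[OF refl]]
    have rad: "radius p (fst R) = r R" "radius p (fst R') = r R'" by (simp_all add: sel r_def)
    show "dist (centre p s) (corner1 p (side_edge C s)) = radius p (fst s)"
      "dist (centre p s) (corner2 p (side_edge C s)) = radius p (fst s)"
      "dist (centre p (opposite_side C s)) (corner1 p (side_edge C s)) = radius p (fst (opposite_side C s))"
      "dist (centre p (opposite_side C s)) (corner2 p (side_edge C s)) = radius p (fst (opposite_side C s))"
      "angle_at (centre p s) (corner1 p (side_edge C s)) (centre p (opposite_side C s)) = pi - D (side_edge C s)"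
      "angle_at (centre p s) (corner2 p (side_edge C s)) (centre p (opposite_side C s)) = pi - D (side_edge C s)"
      using cases by (elim disjE; simp add: sel(2,3) R R' opp_R rad corners corners(3,6)[THEN trans[OF angle_at_commute]])+
  qed (simp add: sel)
  with sel(1) show ?thesis by blast
qed

lemma dist_opposite_centres:
  assumes p: "euclidean_circle_pattern C D p" and s: "s \<in> sides C"
  shows "(dist (centre p s) (centre p (opposite_side C s)))\<^sup>2 =
      (radius p (fst s))\<^sup>2 + (radius p (fst (opposite_side C s)))\<^sup>2 +
      2 * radius p (fst s) * radius p (fst (opposite_side C s)) * cos (D (side_edge C s))"
    and "centre p s \<noteq> centre p (opposite_side C s)"
proof -
  show d: "(dist (centre p s) (centre p (opposite_side C s)))\<^sup>2 =
      (radius p (fst s))\<^sup>2 + (radius p (fst (opposite_side C s)))\<^sup>2 +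
      2 * radius p (fst s) * radius p (fst (opposite_side C s)) * cos (D (side_edge C s))"
    by (rule dist_centres[OF circle_patternD(3,5,7)[OF p s]])
  have "0 < (dist (centre p s) (centre p (opposite_side C s)))\<^sup>2"
    unfolding d using side_D[OF s] circle_patternD(1)[OF p] s opposite_side(1)[OF s]
    by (intro centres_distance_pos)
  then show "centre p s \<noteq> centre p (opposite_side C s)" by auto
qed

text \<open>The radii and \<open>D\<close> determine the distance between the centres by the law of
  cosines, so all distances required by \<open>kite_similarity\<close> scale by
  \<open>c\<close>.\<close>

lemma similar_if_radii_proportional:
  assumes p: "euclidean_circle_pattern C D p" and q: "euclidean_circle_pattern C D q"
    and c: "0 < c" and rad: "\<And>f. f \<in> faces C \<Longrightarrow> radius q f = c * radius p f"
  shows "similar_patterns C p q"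
  unfolding similar_patterns_def
proof (intro exI[of _ c] conjI ballI c rad)
  fix e assume "e \<in> edges C"
  then obtain s where s: "s \<in> sides C" "side_edge C s = e" using edge_has_side by blast
  define s' where "s' = opposite_side C s"
  have s': "s' \<in> sides C" unfolding s'_def by (rule opposite_side(1)[OF s(1)])
  have r: "radius q (fst s) = c * radius p (fst s)" "radius q (fst s') = c * radius p (fst s')"
    using s s' by (auto intro!: rad simp: sides_def)
  note P = circle_patternD[OF p s(1), unfolded s(2), folded s'_def]
  note Q = circle_patternD[OF q s(1), unfolded s(2), folded s'_def]
  have "(dist (centre q s) (centre q s'))\<^sup>2 = (c * dist (centre p s) (centre p s'))\<^sup>2"
    using dist_opposite_centres(1)[OF p s(1)] dist_opposite_centres(1)[OF q s(1)]
    by (simp add: power_mult_distrib r flip: s'_def) (simp add: power2_eq_square algebra_simps)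
  then have d: "dist (centre q s) (centre q s') = c * dist (centre p s) (centre p s')"
    using c by (simp add: power2_eq_iff_nonneg)
  obtain T where T: "\<forall>x y. dist (T x) (T y) = c * dist x y" "T (centre p s) = centre q s"
    "T (centre p s') = centre q s'" "T (corner1 p e) = corner1 q e" "T (corner2 p e) = corner2 q e"
    using kite_similarity[OF c dist_opposite_centres(2)[OF p s(1), folded s'_def] P(2) Q(2) _ _ d] P Q r
    by auto
  moreover have "T (centre p s'') = centre q s''" if "s'' \<in> sides C" "side_edge C s'' = e" for s''
    using sides_of_edge[OF s(1)] that s(2) T by (auto simp: s'_def)
  ultimately show "\<exists>T. (\<forall>x y. dist (T x) (T y) = c * dist x y) \<and>
      T (corner1 p e) = corner1 q e \<and> T (corner2 p e) = corner2 q e \<and>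
      (\<forall>s\<in>sides C. side_edge C s = e \<longrightarrow> T (centre p s) = centre q s)"
    by (intro exI[of _ T]) simp
qed

text \<open>Equal cone angles make the logarithmic radii differ by a constant \<open>c\<close>, that
  is, the radii by the factor \<open>exp c\<close>.\<close>

lemma circle_pattern_unique:
  assumes p: "euclidean_circle_pattern C D p" and q: "euclidean_circle_pattern C D q"
    and eq: "\<And>f. f \<in> faces C \<Longrightarrow> cone_angle C p f = cone_angle C q f"
  shows "similar_patterns C p q"
proof -
  obtain c where c: "\<forall>f\<in>faces C. ln (radius q f) = ln (radius p f) + c"
    using half_cone_unique[of "\<lambda>f. ln (radius p f)" "\<lambda>f. ln (radius q f)"] eq
    by (auto simp: cone_angle_eq[OF p] cone_angle_eq[OF q])
  have pos: "0 < radius p f" "0 < radius q f" if "f \<in> faces C" for f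
    using p q that by (auto simp: euclidean_circle_pattern_def)
  have "radius q f = exp c * radius p f" if "f \<in> faces C" for f
    using c that pos[OF that] exp_ln[of "radius q f"] by (simp add: exp_add mult.commute)
  then show ?thesis by (intro similar_if_radii_proportional[OF p q, of "exp c"]) auto
qed

end

theorem theorem1p1:
  fixes S :: "'a topology" and C :: "'a cell_complex"
    and D :: "'a set \<Rightarrow> real" and \<Phi> :: "'a set \<Rightarrow> real"
  assumes "closed_surface S" and "cell_decomposition S C"
    and "\<forall>e\<in>edges C. 0 < D e \<and> D e < pi"
    and "\<forall>f\<in>faces C. 0 < \<Phi> f"
  shows "(\<exists>p. (euclidean_circle_pattern C D p \<and> (\<forall>f\<in>faces C. cone_angle C p f = \<Phi> f)) \<and>
              (\<forall>q. euclidean_circle_pattern C D q \<and> (\<forall>f\<in>faces C. cone_angle C q f = \<Phi> f)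
                   \<longrightarrow> similar_patterns C p q))
     \<longleftrightarrow>
         (\<Sum>f\<in>faces C. \<Phi> f / 2) = (\<Sum>e\<in>edges C. D e) \<and>
         (\<forall>X. X \<subseteq> faces C \<and> X \<noteq> {} \<and> X \<noteq> faces C \<longrightarrow>
              (\<Sum>f\<in>X. \<Phi> f / 2) < (\<Sum>e\<in>edges_of C X. D e))"
    (is "?pattern \<longleftrightarrow> ?total \<and> ?less")
proof -
  interpret weighted_surface S C D using assms by unfold_locales auto
  \<comment> \<open>For the set of all faces every side is inner, and the two sides of an edge share
    its weight.\<close>
  have total: "(\<Sum>e\<in>edges C. D e) = (\<Sum>s\<in>sides C. D (side_edge C s) / 2)"
    using sum_edges_of[of "faces C"] by (simp add: edges_of_faces inner_F border_F)
  show ?thesis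
  proof
    assume ?pattern
    then obtain p where p: "euclidean_circle_pattern C D p" "\<forall>f\<in>faces C. cone_angle C p f = \<Phi> f" by blast
    \<comment> \<open>The pattern is used only through its logarithmic radii, which solve the cone
      angle equations.\<close>
    then have half: "\<Phi> f / 2 = half_cone (\<lambda>f. ln (radius p f)) f" if "f \<in> faces C" for f
      using cone_angle_eq[OF p(1) that] that by simp
    have ?total using total_half_cone total half by simp
    moreover have ?less
    proof (intro allI impI)
      fix X assume X: "X \<subseteq> faces C \<and> X \<noteq> {} \<and> X \<noteq> faces C"
      then have "(\<Sum>f\<in>X. \<Phi> f / 2) = (\<Sum>f\<in>X. half_cone (\<lambda>f. ln (radius p f)) f)"
        by (intro sum.cong refl half) auto
      with half_cone_sum_less[of X] sum_edges_of[of X] X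
      show "(\<Sum>f\<in>X. \<Phi> f / 2) < (\<Sum>e\<in>edges_of C X. D e)" by simp
    qed
    ultimately show "?total \<and> ?less" ..
  next
    assume rhs: "?total \<and> ?less"
    have "\<exists>\<rho>. \<forall>f\<in>faces C. half_cone \<rho> f = \<Phi> f / 2"
    proof (rule ex_half_cone)
      show "(\<Sum>f\<in>faces C. \<Phi> f / 2) = (\<Sum>s\<in>sides C. D (side_edge C s) / 2)" using rhs total by simp
      show "(\<Sum>f\<in>X. \<Phi> f / 2) < (\<Sum>s\<in>inner X. D (side_edge C s) / 2) + (\<Sum>s\<in>border X. D (side_edge C s))"
        if "X \<subseteq> faces C" "X \<noteq> {}" "X \<noteq> faces C" for X
        using rhs that sum_edges_of[OF that(1)] by auto
    qed
    then obtain \<rho> where \<rho>: "\<forall>f\<in>faces C. half_cone \<rho> f = \<Phi> f / 2" by blast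
    obtain p where p: "euclidean_circle_pattern C D p" "\<forall>f. radius p f = exp (\<rho> f)"
      using circle_pattern_exists by blast
    then have "cone_angle C p f = \<Phi> f" if "f \<in> faces C" for f
      using cone_angle_eq[OF p(1) that] \<rho> that by simp
    then show ?pattern using p(1) circle_pattern_unique by (intro exI[of _ p]) auto
  qed
qed

end
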